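(* Let $n$ be a non-negative integer and let $f,g:\{0,1\}^n\to\{0,1\}$ be increasing Boolean functions. Then the equality $$\mathrm{Cov}(f,g)=4\sum_{\varnothing\neq S\subseteq[n]}|S|\,\hat f(S)^2\,\hat g(S)^2$$ holds if and only if one of the following alternatives holds: (1) $\mathcal R(f)\cap\mathcal R(g)=\varnothing$; (2) there is a coordinate $i\in[n]$ such that $f(x)=g(x)=x_i$ for all $x\in\{0,1\}^n$; (3) there are two distinct coordinates $i,j\in[n]$ such that, after possibly interchanging $f$ and $g$, $f(x)=x_ix_j$ and $g(x)=x_i\vee x_j$ for all $x\in\{0,1\}^n$, where $x_i\vee x_j=1-(1-x_i)(1-x_j)$.
   Context: The cube $\{0,1\}^n$ carries the uniform probability measure, and $\mathbb{E},\mathbb{P}$ denote expectation and probability with respect to it. $\mathrm{Cov}(f,g):=\mathbb{E}[fg]-\mathbb{E}[f]\mathbb{E}[g]$. A function on $\{0,1\}^n$ is increasing if it is (weakly) increasing with respect to the coordinatewise order. $[n]=\{1,\dots,n\}$. For $S\subseteq[n]$, $\chi_S(x):=(-1)^{\sum_{i\in S}x_i}$ and $\hat f(S):=\mathbb{E}[f\chi_S]$. The influence of coordinate $i$ is $\mathrm{Inf}_i[f]:=\mathbb{P}[f(x)\neq f(x\oplus e_i)]$, where $e_i$ is the $i$-th standard basis vector and $\oplus$ is coordinatewise addition modulo $2$. The set of relevant coordinates of $f$ is $\mathcal R(f):=\{i\in[n]:\mathrm{Inf}_i[f]>0\}$. *)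

theory Defs
  imports "HOL-Probability.Probability"
begin

text \<open>
  Points of the cube are extensional functions on the index set \<open>{1..n}\<close> with values in
  \<open>{0, 1}\<close>. They all agree outside \<open>{1..n}\<close>, so the pointwise order on functions
  restricts to the coordinatewise order on the cube, and \<open>mono_on (cube n) f\<close> says that \<open>f\<close>
  is increasing. For \<open>n = 0\<close> the cube is a single point.
\<close>

definition cube :: "nat \<Rightarrow> (nat \<Rightarrow> nat) set" where
  "cube n = {1..n} \<rightarrow>\<^sub>E {0, 1}"

definition expect :: "nat \<Rightarrow> ((nat \<Rightarrow> nat) \<Rightarrow> real) \<Rightarrow> real" where
  "expect n f = measure_pmf.expectation (pmf_of_set (cube n)) f"

definition cov :: "nat \<Rightarrow> ((nat \<Rightarrow> nat) \<Rightarrow> real) \<Rightarrow> ((nat \<Rightarrow> nat) \<Rightarrow> real) \<Rightarrow> real" where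
  "cov n f g = expect n (\<lambda>x. f x * g x) - expect n f * expect n g"

definition chi :: "nat set \<Rightarrow> (nat \<Rightarrow> nat) \<Rightarrow> real" where
  "chi S x = (- 1) ^ (\<Sum>i\<in>S. x i)"

definition fourier :: "nat \<Rightarrow> ((nat \<Rightarrow> nat) \<Rightarrow> real) \<Rightarrow> nat set \<Rightarrow> real" where
  "fourier n f S = expect n (\<lambda>x. f x * chi S x)"

definition cube_add :: "nat \<Rightarrow> (nat \<Rightarrow> nat) \<Rightarrow> (nat \<Rightarrow> nat) \<Rightarrow> (nat \<Rightarrow> nat)" where
  "cube_add n x y = (\<lambda>k\<in>{1..n}. (x k + y k) mod 2)"

definition basis_vec :: "nat \<Rightarrow> nat \<Rightarrow> (nat \<Rightarrow> nat)" where
  "basis_vec n i = (\<lambda>k\<in>{1..n}. if k = i then 1 else 0)"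

definition influence :: "nat \<Rightarrow> ((nat \<Rightarrow> nat) \<Rightarrow> real) \<Rightarrow> nat \<Rightarrow> real" where
  "influence n f i =
     measure_pmf.prob (pmf_of_set (cube n)) {x. f x \<noteq> f (cube_add n x (basis_vec n i))}"

definition relevant :: "nat \<Rightarrow> ((nat \<Rightarrow> nat) \<Rightarrow> real) \<Rightarrow> nat set" where
  "relevant n f = {i \<in> {1..n}. influence n f i > 0}"

definition and_or_pair ::
  "nat \<Rightarrow> nat \<Rightarrow> nat \<Rightarrow> ((nat \<Rightarrow> nat) \<Rightarrow> real) \<Rightarrow> ((nat \<Rightarrow> nat) \<Rightarrow> real) \<Rightarrow> bool" where
  "and_or_pair n i j f g \<longleftrightarrow>
     (\<forall>x \<in> cube n. f x = real (x i) * real (x j) \<and>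
                   g x = 1 - (1 - real (x i)) * (1 - real (x j)))"

end

theory Submission
  imports Defs
begin

text \<open>
  For increasing \<open>f\<close>, \<open>g\<close> the derivatives \<open>u = D\<^sub>i f\<close> and \<open>v = D\<^sub>i g\<close> are Boolean. Writing \<open>h S\<close> for the
  product of the Fourier coefficients of \<open>u\<close> and \<open>v\<close> at \<open>S\<close>, the covariance is a quarter of the sum over
  \<open>i\<close> of \<open>L = \<Sum>\<^sub>S h S / (|S| + 1)\<close>, and the right-hand side is a quarter of the sum of
  \<open>R = \<Sum>\<^sub>S (h S)\<^sup>2\<close>. In fact \<open>R \<le> L\<close> for all Boolean \<open>u\<close>, \<open>v\<close>, monotone or not. By induction on the
  dimension \<open>m\<close>: \<open>(m + 1) L\<close> equals \<open>h {}\<close> plus the sum over the coordinates of the averages of \<open>L\<close> over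
  the two facets, while the same averages of \<open>R\<close> sum to \<open>m R\<close> plus a sum over the edges \<open>(S, S + j)\<close> of
  the cube of terms that are at least \<open>- 2 |h S h (S + j)|\<close>. The cube is bipartite, so the sum of the
  latter is controlled by \<open>(\<Sum>\<^sub>S |h S|)\<^sup>2\<close> as in Motzkin-Straus, and Cauchy-Schwarz closes the induction.
  Tracing equality, \<open>L = R\<close> only if \<open>u\<close> or \<open>v\<close> vanishes, \<open>u = v = 1\<close>, or \<open>u\<close> and \<open>v\<close> are \<open>x\<^sub>j\<close> and
  \<open>1 - x\<^sub>j\<close>; for a common relevant coordinate \<open>i\<close> the last two cases determine \<open>f\<close> and \<open>g\<close>.
\<close>

section \<open>Fourier coefficients on the subsets of a finite set\<close>

text \<open>
  Points of the cube are encoded as subsets of \<open>V\<close>, so that facets are obtained by \<open>insert j\<close>.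
  \<open>L\<close> and \<open>R\<close> above are \<open>noise_form\<close> and \<open>quartic_form\<close>.
\<close>

definition hat :: "'a set \<Rightarrow> ('a set \<Rightarrow> real) \<Rightarrow> 'a set \<Rightarrow> real" where
  "hat V F S = (\<Sum>X\<in>Pow V. (-1) ^ card (X \<inter> S) * F X) / 2 ^ card V"

lemma sum_Pow_insert:
  fixes \<phi> :: "'a set \<Rightarrow> 'b::comm_monoid_add"
  assumes "finite V" "j \<notin> V"
  shows "(\<Sum>X\<in>Pow (insert j V). \<phi> X) = (\<Sum>X\<in>Pow V. \<phi> X) + (\<Sum>X\<in>Pow V. \<phi> (insert j X))"
proof -
  have "inj_on (insert j) (Pow V)"
    using assms(2) by (auto simp: inj_on_def)
  moreover have "Pow V \<inter> insert j ` Pow V = {}"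
    using assms(2) by auto
  ultimately show ?thesis
    using assms(1) by (simp add: Pow_insert sum.union_disjoint sum.reindex)
qed

lemma sum_Pow_remove:
  fixes \<phi> :: "'a set \<Rightarrow> 'b::comm_monoid_add"
  assumes "finite V" "j \<in> V"
  shows "(\<Sum>X\<in>Pow V. \<phi> X) = (\<Sum>X\<in>Pow (V - {j}). \<phi> X) + (\<Sum>X\<in>Pow (V - {j}). \<phi> (insert j X))"
  using sum_Pow_insert[of "V - {j}" j \<phi>] assms by (simp add: insert_absorb)

text \<open>The sum over \<open>X\<close> splits by whether \<open>j \<in> X\<close>, and inserting
  \<open>j\<close> into \<open>S\<close> flips the sign exactly on the half with
  \<open>j \<in> X\<close>. Conversely, the coefficients of the two facet restrictions at
  \<open>S\<close> are the sum and the difference of those of \<open>F\<close> at \<open>S\<close>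
  and at \<open>insert j S\<close>.\<close>

lemma hat_remove:
  assumes "finite V" "j \<in> V" "j \<notin> S"
  shows "hat V F S = (hat (V - {j}) F S + hat (V - {j}) (\<lambda>X. F (insert j X)) S) / 2"
    and "hat V F (insert j S) = (hat (V - {j}) F S - hat (V - {j}) (\<lambda>X. F (insert j X)) S) / 2"
proof -
  have c: "card V = Suc (card (V - {j}))"
    using assms(1,2) by (rule card.remove)
  have 1: "insert j X \<inter> S = X \<inter> S" for X
    using assms by auto
  have 2: "card (insert j X \<inter> insert j S) = Suc (card (X \<inter> S))" if "X \<in> Pow (V - {j})" for X
  proof -
    have "insert j X \<inter> insert j S = insert j (X \<inter> S)" "j \<notin> X \<inter> S" "finite (X \<inter> S)"
      using that assms finite_subset[of "X \<inter> S" V] by auto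
    then show ?thesis by simp
  qed
  have 3: "X \<inter> insert j S = X \<inter> S" if "X \<in> Pow (V - {j})" for X
    using that by blast
  have 4: "(\<Sum>X\<in>Pow (V - {j}). (-1) ^ card (X \<inter> insert j S) * F X)
      = (\<Sum>X\<in>Pow (V - {j}). (-1) ^ card (X \<inter> S) * F X)"
    by (intro sum.cong refl) (simp only: 3)
  have 5: "(\<Sum>X\<in>Pow (V - {j}). (-1) ^ card (insert j X \<inter> insert j S) * F (insert j X))
      = - (\<Sum>X\<in>Pow (V - {j}). (-1) ^ card (X \<inter> S) * F (insert j X))"
    unfolding sum_negf[symmetric] by (intro sum.cong refl) (simp only: 2, simp)
  show "hat V F S = (hat (V - {j}) F S + hat (V - {j}) (\<lambda>X. F (insert j X)) S) / 2"
    unfolding hat_def sum_Pow_remove[OF assms(1,2)] c 1 by (simp add: add_divide_distrib)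
  show "hat V F (insert j S) = (hat (V - {j}) F S - hat (V - {j}) (\<lambda>X. F (insert j X)) S) / 2"
    unfolding hat_def sum_Pow_remove[OF assms(1,2)] c 4 5 by (simp add: diff_divide_distrib)
qed

lemma hat_diff: "hat V (\<lambda>X. F X - G X) S = hat V F S - hat V G S"
  unfolding hat_def by (simp add: algebra_simps sum_subtractf diff_divide_distrib)

lemma hat_cong: "(\<And>X. X \<subseteq> V \<Longrightarrow> F X = G X) \<Longrightarrow> hat V F S = hat V G S"
  unfolding hat_def by (intro arg_cong2[where f="(/)"] sum.cong) auto

text \<open>In facet coefficients the pair \<open>S\<close>, \<open>insert j S\<close> contributes
  \<open>((A + B) * (C + D) + (A - B) * (C - D)) / 4 = (A * C + B * D) / 2\<close>, so the identity
  for \<open>insert j V\<close> is the average of the identities on its two facets.\<close>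

lemma parseval:
  assumes "finite V"
  shows "(\<Sum>S\<in>Pow V. hat V F S * hat V G S) = hat V (\<lambda>X. F X * G X) {}"
  using assms
proof (induction V arbitrary: F G rule: finite_induct)
  case empty
  then show ?case by (simp add: hat_def)
next
  case (insert j V)
  let ?F = "\<lambda>X. F (insert j X)" and ?G = "\<lambda>X. G (insert j X)"
  have V: "insert j V - {j} = V" using insert by auto
  have nin: "j \<notin> S" if "S \<in> Pow V" for S using insert that by auto
  have rem: "hat (insert j V) H S = (hat V H S + hat V (\<lambda>X. H (insert j X)) S) / 2"
    "hat (insert j V) H (insert j S) = (hat V H S - hat V (\<lambda>X. H (insert j X)) S) / 2"
    if "j \<notin> S" for H S
    using hat_remove[of "insert j V" j S H] insert that unfolding V by auto
  have "(\<Sum>S\<in>Pow (insert j V). hat (insert j V) F S * hat (insert j V) G S)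
      = (\<Sum>S\<in>Pow V. (hat V F S * hat V G S + hat V ?F S * hat V ?G S) / 2)"
    unfolding sum_Pow_insert[OF insert(1,2)] sum.distrib[symmetric]
    by (intro sum.cong refl) (simp add: rem nin field_simps)
  also have "\<dots> = (hat V (\<lambda>X. F X * G X) {} + hat V (\<lambda>X. ?F X * ?G X) {}) / 2"
    by (simp add: sum_divide_distrib[symmetric] sum.distrib insert.IH)
  also have "\<dots> = hat (insert j V) (\<lambda>X. F X * G X) {}"
    by (simp add: rem)
  finally show ?case .
qed

section \<open>Double counting and averages over facets\<close>

text \<open>A set \<open>T\<close> arises as \<open>insert j S\<close> once for each
  \<open>j \<in> T\<close>.\<close>

lemma sum_remove_Pow_insert:
  fixes \<phi> :: "'a set \<Rightarrow> real"
  assumes "finite V"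
  shows "(\<Sum>j\<in>V. \<Sum>S\<in>Pow (V - {j}). \<phi> (insert j S)) = (\<Sum>T\<in>Pow V. card T * \<phi> T)"
proof -
  have "(\<Sum>S\<in>Pow (V - {j}). \<phi> (insert j S)) = (\<Sum>T\<in>Pow V. if j \<in> T then \<phi> T else 0)" if "j \<in> V" for j
    using sum_Pow_remove[OF assms that, of "\<lambda>T. if j \<in> T then \<phi> T else 0"]
    by (auto intro!: sum.neutral)
  then have "(\<Sum>j\<in>V. \<Sum>S\<in>Pow (V - {j}). \<phi> (insert j S))
      = (\<Sum>T\<in>Pow V. \<Sum>j\<in>V. if j \<in> T then \<phi> T else 0)"
    by (subst sum.swap) simp
  also have "\<dots> = (\<Sum>T\<in>Pow V. card T * \<phi> T)"
  proof (intro sum.cong refl)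
    fix T assume "T \<in> Pow V"
    then have "V \<inter> T = T" by auto
    then show "(\<Sum>j\<in>V. if j \<in> T then \<phi> T else 0) = card T * \<phi> T"
      using assms by (simp add: sum.inter_restrict[symmetric])
  qed
  finally show ?thesis .
qed

text \<open>A set \<open>T\<close> lies in \<open>V - {j}\<close> for the
  \<open>card V - card T\<close> coordinates \<open>j\<close> outside it.\<close>

lemma sum_remove_Pow:
  fixes \<phi> :: "'a set \<Rightarrow> real"
  assumes "finite V"
  shows "(\<Sum>j\<in>V. \<Sum>S\<in>Pow (V - {j}). \<phi> S) = (\<Sum>T\<in>Pow V. (real (card V) - card T) * \<phi> T)"
proof -
  have "(\<Sum>j\<in>V. \<Sum>S\<in>Pow (V - {j}). \<phi> S)
      = (\<Sum>j\<in>V. (\<Sum>S\<in>Pow V. \<phi> S) - (\<Sum>S\<in>Pow (V - {j}). \<phi> (insert j S)))"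
    using sum_Pow_remove[OF assms, of _ \<phi>] by (intro sum.cong) auto
  then show ?thesis
    using sum_remove_Pow_insert[OF assms, of \<phi>]
    by (simp add: sum_subtractf algebra_simps sum_distrib_left)
qed

definition noise_form :: "'a set \<Rightarrow> ('a set \<Rightarrow> real) \<Rightarrow> ('a set \<Rightarrow> real) \<Rightarrow> real" where
  "noise_form V F G = (\<Sum>S\<in>Pow V. hat V F S * hat V G S / (real (card S) + 1))"

definition quartic_form :: "'a set \<Rightarrow> ('a set \<Rightarrow> real) \<Rightarrow> ('a set \<Rightarrow> real) \<Rightarrow> real" where
  "quartic_form V F G = (\<Sum>S\<in>Pow V. (hat V F S)\<^sup>2 * (hat V G S)\<^sup>2)"

text \<open>The cross terms in the average of \<open>quartic_form\<close> over two facets: if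
  \<open>p\<close>, \<open>q\<close> and \<open>r\<close>, \<open>s\<close> are the coefficients of
  \<open>F\<close> and \<open>G\<close> at \<open>S\<close> and \<open>insert j S\<close>, then
  \<open>((p + q)^2 * (r + s)^2 + (p - q)^2 * (r - s)^2) / 2\<close> is
  \<open>p^2 * r^2 + q^2 * s^2\<close> plus this term.\<close>

definition edge :: "'a set \<Rightarrow> ('a set \<Rightarrow> real) \<Rightarrow> ('a set \<Rightarrow> real) \<Rightarrow> 'a \<Rightarrow> 'a set \<Rightarrow> real" where
  "edge V F G j S = (hat V F (insert j S))\<^sup>2 * (hat V G S)\<^sup>2 + (hat V F S)\<^sup>2 * (hat V G (insert j S))\<^sup>2
     + 4 * (hat V F S * hat V G S) * (hat V F (insert j S) * hat V G (insert j S))"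

text \<open>The facet weight \<open>1 / (card S + 1)\<close> equals
  \<open>1 / card (insert j S)\<close> at the upper end of the edge. With \<open>m = card V\<close>,
  a nonempty \<open>T\<close> therefore collects
  \<open>(m - |T|) / (|T| + 1) + 1 = (m + 1) / (|T| + 1)\<close>; the empty set misses the
  \<open>+ 1\<close>, which gives the separate term.\<close>

lemma noise_form_recurrence:
  assumes "finite V"
  shows "(real (card V) + 1) * noise_form V F G = hat V F {} * hat V G {}
    + (\<Sum>j\<in>V. (noise_form (V - {j}) F G + noise_form (V - {j}) (\<lambda>X. F (insert j X)) (\<lambda>X. G (insert j X))) / 2)"
proof -
  define h where "h S = hat V F S * hat V G S" for S
  have "(noise_form (V - {j}) F G + noise_form (V - {j}) (\<lambda>X. F (insert j X)) (\<lambda>X. G (insert j X))) / 2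
      = (\<Sum>S\<in>Pow (V - {j}). h S / (real (card S) + 1)) + (\<Sum>S\<in>Pow (V - {j}). h (insert j S) / card (insert j S))"
    if "j \<in> V" for j
    unfolding noise_form_def sum_divide_distrib sum.distrib[symmetric]
  proof (intro sum.cong refl)
    fix S assume S: "S \<in> Pow (V - {j})"
    then have "j \<notin> S" "finite S" using assms by (auto intro: finite_subset)
    then have c: "real (card (insert j S)) = real (card S) + 1" by simp
    show "(hat (V - {j}) F S * hat (V - {j}) G S / (real (card S) + 1)
        + hat (V - {j}) (\<lambda>X. F (insert j X)) S * hat (V - {j}) (\<lambda>X. G (insert j X)) S / (real (card S) + 1)) / 2
      = h S / (real (card S) + 1) + h (insert j S) / real (card (insert j S))"
      unfolding c h_def hat_remove[OF assms that \<open>j \<notin> S\<close>] add_divide_distrib[symmetric]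
      by (simp add: field_simps)
  qed
  then have "(\<Sum>j\<in>V. (noise_form (V - {j}) F G + noise_form (V - {j}) (\<lambda>X. F (insert j X)) (\<lambda>X. G (insert j X))) / 2)
     = (\<Sum>j\<in>V. (\<Sum>S\<in>Pow (V - {j}). h S / (real (card S) + 1))
         + (\<Sum>S\<in>Pow (V - {j}). h (insert j S) / card (insert j S)))"
    by (intro sum.cong refl) blast
  also have "\<dots> = (\<Sum>T\<in>Pow V. (real (card V) - card T) * (h T / (real (card T) + 1)) + card T * (h T / card T))"
    using sum_remove_Pow[OF assms, of "\<lambda>S. h S / (real (card S) + 1)"]
      sum_remove_Pow_insert[OF assms, of "\<lambda>S. h S / card S"]
    by (simp only: sum.distrib)
  \<comment> \<open>At \<open>T = {}\<close> the summand \<open>card T * (h T / card T)\<close> is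
    \<open>0\<close> and not \<open>h T\<close>; the conditional accounts for this.\<close>
  also have "\<dots> = (\<Sum>T\<in>Pow V. (real (card V) + 1) * (h T / (real (card T) + 1)) - (if T = {} then h T else 0))"
  proof (intro sum.cong refl)
    fix T assume "T \<in> Pow V"
    then have "finite T" using assms by (auto intro: finite_subset)
    then show "(real (card V) - card T) * (h T / (real (card T) + 1)) + card T * (h T / card T)
      = (real (card V) + 1) * (h T / (real (card T) + 1)) - (if T = {} then h T else 0)"
    proof (cases "T = {}")
      case False
      have "(real (card V) - card T) * (h T / (real (card T) + 1)) + h T
          = (real (card V) + 1) * (h T / (real (card T) + 1))"
        by (simp add: divide_simps) (simp add: algebra_simps)
      with False \<open>finite T\<close> show ?thesis by simp
    qed (simp add: algebra_simps)
  qed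
  also have "\<dots> = (real (card V) + 1) * noise_form V F G - h {}"
    using assms by (simp add: sum_subtractf sum_distrib_left noise_form_def h_def sum.delta)
  finally show ?thesis by (simp add: h_def)
qed

lemma quartic_form_average:
  assumes "finite V"
  shows "(\<Sum>j\<in>V. (quartic_form (V - {j}) F G + quartic_form (V - {j}) (\<lambda>X. F (insert j X)) (\<lambda>X. G (insert j X))) / 2)
    = card V * quartic_form V F G + (\<Sum>j\<in>V. \<Sum>S\<in>Pow (V - {j}). edge V F G j S)"
proof -
  have "(quartic_form (V - {j}) F G + quartic_form (V - {j}) (\<lambda>X. F (insert j X)) (\<lambda>X. G (insert j X))) / 2
      = quartic_form V F G + (\<Sum>S\<in>Pow (V - {j}). edge V F G j S)" if "j \<in> V" for j
    unfolding quartic_form_def sum_Pow_remove[OF assms that] sum_divide_distrib sum.distrib[symmetric]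
  proof (intro sum.cong refl)
    fix S assume S: "S \<in> Pow (V - {j})"
    then have "j \<notin> S" by auto
    define A B C D where "A = hat (V - {j}) F S" and "B = hat (V - {j}) (\<lambda>X. F (insert j X)) S"
      and "C = hat (V - {j}) G S" and "D = hat (V - {j}) (\<lambda>X. G (insert j X)) S"
    show "((hat (V - {j}) F S)\<^sup>2 * (hat (V - {j}) G S)\<^sup>2
        + (hat (V - {j}) (\<lambda>X. F (insert j X)) S)\<^sup>2 * (hat (V - {j}) (\<lambda>X. G (insert j X)) S)\<^sup>2) / 2
      = (hat V F S)\<^sup>2 * (hat V G S)\<^sup>2 + (hat V F (insert j S))\<^sup>2 * (hat V G (insert j S))\<^sup>2 + edge V F G j S"
      unfolding edge_def hat_remove[OF assms that \<open>j \<notin> S\<close>] A_def[symmetric] B_def[symmetric]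
        C_def[symmetric] D_def[symmetric]
      by (simp add: field_simps power2_eq_square)
  qed
  then have "(\<Sum>j\<in>V. (quartic_form (V - {j}) F G + quartic_form (V - {j}) (\<lambda>X. F (insert j X)) (\<lambda>X. G (insert j X))) / 2)
      = (\<Sum>j\<in>V. quartic_form V F G + (\<Sum>S\<in>Pow (V - {j}). edge V F G j S))"
    by (intro sum.cong refl) blast
  then show ?thesis by (simp only: sum.distrib sum_constant)
qed

section \<open>Edge sums and sums of squares\<close>

text \<open>Every edge joins a set of even size to one of odd size. Orienting edges from even to odd
  embeds them into the product of the two parity classes, and the remaining pairs contribute
  nonnegatively.\<close>

lemma sum_edges_le:
  fixes k :: "'a set \<Rightarrow> real"
  assumes "finite V" and "\<And>S. k S \<ge> 0"
  shows "(\<Sum>j\<in>V. \<Sum>S\<in>Pow (V - {j}). k S * k (insert j S))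
    \<le> (\<Sum>S\<in>{S\<in>Pow V. even (card S)}. k S) * (\<Sum>S\<in>{S\<in>Pow V. odd (card S)}. k S)"
    (is "?W \<le> sum k ?E * sum k ?O")
proof -
  define P where "P = Sigma V (\<lambda>j. Pow (V - {j}))"
  define \<phi> :: "'a \<times> 'a set \<Rightarrow> 'a set \<times> 'a set" where "\<phi> = (\<lambda>(j, S). if even (card S) then (S, insert j S) else (insert j S, S))"
  have card: "card (insert j S) = Suc (card S)" if "(j, S) \<in> P" for j S
    using that assms(1) finite_subset[of S V] by (auto simp: P_def subset_Diff_insert)
  have "inj_on \<phi> P"
  proof (rule inj_onI)
    fix x y assume xy: "x \<in> P" "y \<in> P" "\<phi> x = \<phi> y"
    obtain j S i T where [simp]: "x = (j, S)" "y = (i, T)"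
      by (metis surj_pair)
    have "j \<notin> S" "i \<notin> T"
      using xy by (auto simp: P_def)
    then show "x = y"
      using xy(3) by (auto simp: \<phi>_def split: if_splits)
  qed
  have "\<phi> ` P \<subseteq> ?E \<times> ?O"
  proof (rule image_subsetI)
    fix x assume "x \<in> P"
    obtain j S where x: "x = (j, S)"
      by (cases x)
    have "j \<in> V" "S \<subseteq> V" "card (insert j S) = Suc (card S)"
      using card[of j S] \<open>x \<in> P\<close> unfolding x P_def by auto
    then show "\<phi> x \<in> ?E \<times> ?O"
      unfolding x \<phi>_def by simp
  qed
  have "?W = (\<Sum>(j, S)\<in>P. k S * k (insert j S))"
    unfolding P_def using assms(1) by (subst sum.Sigma) auto
  also have "\<dots> = (\<Sum>x\<in>P. case \<phi> x of (S, T) \<Rightarrow> k S * k T)"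
    by (intro sum.cong) (auto simp: \<phi>_def)
  also have "\<dots> = (\<Sum>(S, T)\<in>\<phi> ` P. k S * k T)"
    using \<open>inj_on \<phi> P\<close> by (simp add: sum.reindex)
  also have "\<dots> \<le> (\<Sum>(S, T)\<in>?E \<times> ?O. k S * k T)"
    using assms \<open>\<phi> ` P \<subseteq> ?E \<times> ?O\<close> by (intro sum_mono2) auto
  also have "\<dots> = sum k ?E * sum k ?O"
    by (simp add: sum_product sum.cartesian_product)
  finally show ?thesis .
qed

lemma sum_squares_le_square_sum:
  fixes k :: "'b \<Rightarrow> real"
  assumes "\<And>x. x \<in> A \<Longrightarrow> k x \<ge> 0"
  shows "(\<Sum>x\<in>A. (k x)\<^sup>2) \<le> (\<Sum>x\<in>A. k x)\<^sup>2"
  using assms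
proof (induction A rule: infinite_finite_induct)
  case (insert x A)
  have "0 \<le> k x * (\<Sum>z\<in>A. k z)"
    using insert.prems by (intro mult_nonneg_nonneg sum_nonneg) auto
  then show ?case
    using insert by (simp add: power2_sum)
qed auto

text \<open>Equality leaves no room for the cross term \<open>2 * (k x * s)\<close>, where
  \<open>s\<close> sums the other values, so \<open>k x > 0\<close> forces
  \<open>s = 0\<close>.\<close>

lemma sum_squares_eq_square_sum:
  fixes k :: "'b \<Rightarrow> real"
  assumes "finite A" "\<And>x. x \<in> A \<Longrightarrow> k x \<ge> 0" "(\<Sum>x\<in>A. (k x)\<^sup>2) = (\<Sum>x\<in>A. k x)\<^sup>2"
    and "x \<in> A" "y \<in> A" "x \<noteq> y" "k x > 0"
  shows "k y = 0"
proof -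
  define s where "s = (\<Sum>z\<in>A - {x}. k z)"
  have "(k x)\<^sup>2 + (\<Sum>z\<in>A - {x}. (k z)\<^sup>2) = (k x + s)\<^sup>2"
    using assms(1,3,4) by (simp add: sum.remove s_def)
  moreover have "(\<Sum>z\<in>A - {x}. (k z)\<^sup>2) \<le> s\<^sup>2"
    unfolding s_def using assms(1,2) by (intro sum_squares_le_square_sum) auto
  ultimately have "2 * (k x * s) \<le> 0"
    by (simp add: power2_sum)
  then have "s \<le> 0"
    using assms(7) by (simp add: mult_le_0_iff)
  then show "k y = 0"
    using assms(1,2,5,6) member_le_sum[of y "A - {x}" k] by (fastforce simp: s_def)
qed

section \<open>Estimates for a pair of Boolean functions\<close>

definition boolean :: "'a set \<Rightarrow> ('a set \<Rightarrow> real) \<Rightarrow> bool" where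
  "boolean V F \<longleftrightarrow> (\<forall>X\<subseteq>V. F X \<in> {0, 1})"

lemma hat_empty: "hat V F {} = (\<Sum>X\<in>Pow V. F X) / 2 ^ card V"
  by (simp add: hat_def)

text \<open>\<open>F * F = F\<close> turns the Parseval sum into the mean, and
  \<open>F \<ge> 0\<close> lets the mean dominate every coefficient.\<close>

lemma boolean_hat:
  assumes "finite V" "boolean V F"
  shows hat_empty_nonneg: "0 \<le> hat V F {}"
    and hat_empty_le_1: "hat V F {} \<le> 1"
    and sum_hat_squares: "(\<Sum>S\<in>Pow V. (hat V F S)\<^sup>2) = hat V F {}"
    and abs_hat_le: "\<bar>hat V F S\<bar> \<le> hat V F {}"
proof -
  have F: "0 \<le> F X" "F X \<le> 1" "F X * F X = F X" if "X \<in> Pow V" for X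
    using assms(2) that by (auto simp: boolean_def)
  show "0 \<le> hat V F {}"
    unfolding hat_empty by (intro divide_nonneg_nonneg sum_nonneg F) auto
  have "(\<Sum>X\<in>Pow V. F X) \<le> (\<Sum>X\<in>Pow V. 1)"
    by (intro sum_mono F)
  then show "hat V F {} \<le> 1"
    unfolding hat_empty using assms(1) by (simp add: card_Pow)
  show "(\<Sum>S\<in>Pow V. (hat V F S)\<^sup>2) = hat V F {}"
    unfolding power2_eq_square parseval[OF assms(1)] by (intro hat_cong) (simp add: F)
  have "\<bar>\<Sum>X\<in>Pow V. (-1) ^ card (X \<inter> S) * F X\<bar> \<le> (\<Sum>X\<in>Pow V. F X)"
    by (intro order.trans[OF sum_abs] sum_mono) (simp add: abs_mult power_abs F)
  then show "\<bar>hat V F S\<bar> \<le> hat V F {}"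
    unfolding hat_empty by (simp add: hat_def divide_right_mono)
qed

text \<open>The target of this context is \<open>quartic_form V F G \<le> a * b + M\<close>, which
  the induction step consumes, and its equality case. \<open>M\<close> is the edge sum left over by
  \<open>quartic_form_average\<close>; \<open>k\<close> drops the signs, so that \<open>W\<close>
  can bound \<open>M\<close> from below.\<close>

locale boolean_pair =
  fixes V :: "'a set" and F G :: "'a set \<Rightarrow> real"
  assumes fin: "finite V" and F: "boolean V F" and G: "boolean V G"
begin

definition k :: "'a set \<Rightarrow> real" where "k S = \<bar>hat V F S * hat V G S\<bar>"

abbreviation a :: real where "a \<equiv> hat V F {}"
abbreviation b :: real where "b \<equiv> hat V G {}"

definition K :: real where "K = (\<Sum>S\<in>Pow V - {{}}. k S)"
definition Q :: real where "Q = (\<Sum>S\<in>Pow V - {{}}. (k S)\<^sup>2)"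
definition W :: real where "W = (\<Sum>j\<in>V. \<Sum>S\<in>Pow (V - {j}). k S * k (insert j S))"
definition M :: real where "M = (\<Sum>j\<in>V. \<Sum>S\<in>Pow (V - {j}). edge V F G j S)"

lemma k_nonneg: "0 \<le> k S"
  by (simp add: k_def)

lemma ab_bounds: "0 \<le> a" "a \<le> 1" "0 \<le> b" "b \<le> 1"
  using boolean_hat[OF fin F] boolean_hat[OF fin G] by auto

lemma sum_Pow_empty: "(\<Sum>S\<in>Pow V. \<phi> S) = \<phi> {} + (\<Sum>S\<in>Pow V - {{}}. \<phi> S)" for \<phi> :: "'a set \<Rightarrow> real"
  using fin by (simp add: sum.remove)

lemma k_empty: "k {} = a * b"
  using ab_bounds by (simp add: k_def)

lemma quartic_form_eq: "quartic_form V F G = (a * b)\<^sup>2 + Q"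
  unfolding quartic_form_def Q_def k_def by (simp add: sum_Pow_empty power_mult_distrib)

lemma Q_le: "Q \<le> K\<^sup>2"
  unfolding Q_def K_def by (intro sum_squares_le_square_sum k_nonneg)

lemma K_nonneg: "0 \<le> K"
  unfolding K_def by (intro sum_nonneg k_nonneg)

lemma W_nonneg: "0 \<le> W"
  unfolding W_def by (intro sum_nonneg mult_nonneg_nonneg k_nonneg)

lemma sum_hat_squares_nonempty:
  "(\<Sum>S\<in>Pow V - {{}}. (hat V F S)\<^sup>2) = a * (1 - a)"
  "(\<Sum>S\<in>Pow V - {{}}. (hat V G S)\<^sup>2) = b * (1 - b)"
  using sum_hat_squares[OF fin F] sum_hat_squares[OF fin G]
  by (simp_all add: sum_Pow_empty algebra_simps power2_eq_square)

text \<open>Cauchy-Schwarz over the nonempty sets, where the squared coefficients add up to the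
  variances of \<open>F\<close> and \<open>G\<close>.\<close>

lemma K_squared_le: "K\<^sup>2 \<le> (a * (1 - a)) * (b * (1 - b))"
  unfolding K_def k_def abs_mult sum_hat_squares_nonempty[symmetric]
  by (rule order.trans[OF Cauchy_Schwarz_ineq_sum]) simp

lemma total_squared_le: "(a * b + K)\<^sup>2 \<le> a * b"
proof -
  have "a * b + K = (\<Sum>S\<in>Pow V. \<bar>hat V F S\<bar> * \<bar>hat V G S\<bar>)"
    unfolding K_def k_empty[symmetric] sum_Pow_empty[symmetric] by (simp add: k_def abs_mult)
  then show ?thesis
    using Cauchy_Schwarz_ineq_sum[of "\<lambda>S. \<bar>hat V F S\<bar>" "\<lambda>S. \<bar>hat V G S\<bar>" "Pow V"]
    by (simp add: sum_hat_squares[OF fin F] sum_hat_squares[OF fin G])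
qed

text \<open>The coefficients of one function are bounded by its mean, and those of the other are
  summed by Parseval.\<close>

lemma quartic_form_le: "quartic_form V F G \<le> a * b\<^sup>2" "quartic_form V F G \<le> a\<^sup>2 * b"
proof -
  have "quartic_form V F G \<le> (\<Sum>S\<in>Pow V. (hat V F S)\<^sup>2 * b\<^sup>2)"
    unfolding quartic_form_def using abs_hat_le[OF fin G] ab_bounds
    by (intro sum_mono mult_left_mono) (auto simp: abs_le_square_iff[symmetric])
  then show "quartic_form V F G \<le> a * b\<^sup>2"
    by (simp add: sum_distrib_right[symmetric] sum_hat_squares[OF fin F])
  have "quartic_form V F G \<le> (\<Sum>S\<in>Pow V. a\<^sup>2 * (hat V G S)\<^sup>2)"
    unfolding quartic_form_def using abs_hat_le[OF fin F] ab_bounds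
    by (intro sum_mono mult_right_mono) (auto simp: abs_le_square_iff[symmetric])
  then show "quartic_form V F G \<le> a\<^sup>2 * b"
    by (simp add: sum_distrib_left[symmetric] sum_hat_squares[OF fin G])
qed

text \<open>\<open>e\<close> and \<open>w\<close> are the sums of \<open>k\<close> over the nonempty
  even sets and over the odd sets. The empty set is even, so its share \<open>a * b\<close> joins
  \<open>e\<close> in the bipartite bound.\<close>

lemma W_le:
  obtains e w where "0 \<le> e" "0 \<le> w" "e + w = K" "W \<le> (a * b + e) * w"
proof
  let ?E = "{S \<in> Pow V. even (card S)}" and ?O = "{S \<in> Pow V. odd (card S)}"
  show "0 \<le> sum k (?E - {{}})" "0 \<le> sum k ?O"
    by (intro sum_nonneg k_nonneg)+
  have E: "sum k ?E = a * b + sum k (?E - {{}})"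
    unfolding k_empty[symmetric] using fin by (intro sum.remove) auto
  have "sum k (?E - {{}}) + sum k ?O = sum k ((?E - {{}}) \<union> ?O)"
    using fin by (intro sum.union_disjoint[symmetric]) auto
  also have "(?E - {{}}) \<union> ?O = Pow V - {{}}"
    by auto
  finally show "sum k (?E - {{}}) + sum k ?O = K"
    by (simp add: K_def)
  show "W \<le> (a * b + sum k (?E - {{}})) * sum k ?O"
    unfolding W_def E[symmetric] using fin k_nonneg by (rule sum_edges_le)
qed

text \<open>With \<open>x\<close> the product of all four coefficients, AM-GM bounds the two squares
  below by \<open>2 * |x|\<close>, and \<open>2 * |x| + 4 * x \<ge> - 2 * |x|\<close>, strictly if
  \<open>x > 0\<close>.\<close>

lemma edge_ge: "- 2 * (k S * k (insert j S)) \<le> edge V F G j S"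
  and edge_gt: "0 < (hat V F S * hat V G S) * (hat V F (insert j S) * hat V G (insert j S)) \<Longrightarrow>
    - 2 * (k S * k (insert j S)) < edge V F G j S"
proof -
  define p r q s where "p = hat V F S" and "r = hat V G S"
    and "q = hat V F (insert j S)" and "s = hat V G (insert j S)"
  have "0 \<le> (\<bar>q * r\<bar> - \<bar>p * s\<bar>)\<^sup>2"
    by simp
  then have le: "2 * \<bar>(p * r) * (q * s)\<bar> \<le> q\<^sup>2 * r\<^sup>2 + p\<^sup>2 * s\<^sup>2"
    by (simp add: power2_diff power_mult_distrib abs_mult mult.assoc mult.left_commute mult.commute)
  have e: "edge V F G j S = q\<^sup>2 * r\<^sup>2 + p\<^sup>2 * s\<^sup>2 + 4 * ((p * r) * (q * s))"
    and k: "k S * k (insert j S) = \<bar>(p * r) * (q * s)\<bar>"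
    by (simp_all add: edge_def k_def p_def q_def r_def s_def abs_mult)
  show "- 2 * (k S * k (insert j S)) \<le> edge V F G j S"
    unfolding e k using le by linarith
  show "- 2 * (k S * k (insert j S)) < edge V F G j S"
    if "0 < (hat V F S * hat V G S) * (hat V F (insert j S) * hat V G (insert j S))"
    using that le unfolding e k p_def[symmetric] q_def[symmetric] r_def[symmetric] s_def[symmetric]
    by linarith
qed

lemma M_ge: "- 2 * W \<le> M"
  unfolding M_def W_def sum_distrib_left by (intro sum_mono edge_ge)

text \<open>
  If \<open>a + b < 1\<close> then \<open>min a b < 1 / 2\<close>, and the crude bounds \<open>quartic_form \<le> a b min a b\<close> and
  \<open>4 W \<le> (a b + K)\<^sup>2 \<le> a b\<close> suffice. Otherwise \<open>K \<le> a b\<close>, which makes \<open>2 a b K\<close> the worst case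
  of the bound on \<open>2 W\<close>.
\<close>

lemma quartic_form_W_less:
  assumes "a + b < 1" "0 < a" "0 < b"
  shows "quartic_form V F G + 2 * W < a * b"
proof -
  obtain e w where ew: "0 \<le> e" "0 \<le> w" "e + w = K" "W \<le> (a * b + e) * w"
    by (rule W_le)
  \<comment> \<open>AM-GM for \<open>a * b + e\<close> and \<open>w\<close>, whose sum
    \<open>a * b + K\<close> is controlled by \<open>total_squared_le\<close>.\<close>
  have "4 * ((a * b + e) * w) \<le> (a * b + e + w)\<^sup>2"
    using zero_le_power2[of "a * b + e - w"] by (simp add: power2_eq_square algebra_simps)
  then have "4 * W \<le> a * b"
    using total_squared_le ew by (simp add: add.assoc)
  moreover have "2 * quartic_form V F G < a * b"
  proof (cases "a \<le> b")
    case True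
    have "a * b * a < a * b * (1/2)"
      using True assms by (intro mult_strict_left_mono) auto
    then show ?thesis using quartic_form_le(2) by (simp add: power2_eq_square algebra_simps)
  next
    case False
    have "a * b * b < a * b * (1/2)"
      using False assms by (intro mult_strict_left_mono) auto
    then show ?thesis using quartic_form_le(1) by (simp add: power2_eq_square algebra_simps)
  qed
  ultimately show ?thesis by linarith
qed

lemma two_W_le:
  assumes "1 \<le> a + b"
  shows "2 * W \<le> a * b * (2 * K)" "a * b * (2 * K) \<le> a * b * ((1 - a) * b + (1 - b) * a)"
    "(2 * K)\<^sup>2 \<le> ((1 - a) * b + (1 - b) * a)\<^sup>2 - ((1 - a) * b - (1 - b) * a)\<^sup>2"
proof -
  obtain e w where ew: "0 \<le> e" "0 \<le> w" "e + w = K" "W \<le> (a * b + e) * w"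
    by (rule W_le)
  have ab: "0 \<le> a * b"
    using ab_bounds by simp
  \<comment> \<open>Here \<open>1 \<le> a + b\<close> enters; it brings the product of the
    variances, which bounds \<open>K^2\<close>, below \<open>(a * b)^2\<close>.\<close>
  have "(1 - a) * (1 - b) \<le> a * b"
    using assms by (simp add: algebra_simps)
  then have "(a * b) * ((1 - a) * (1 - b)) \<le> (a * b) * (a * b)"
    using ab by (rule mult_left_mono)
  then have "K\<^sup>2 \<le> (a * b)\<^sup>2"
    using K_squared_le by (simp add: power2_eq_square mult.commute mult.left_commute)
  then have "K \<le> a * b"
    using ab by (rule power2_le_imp_le)
  then have "0 \<le> e * (a * b - K) + e * e"
    using ew by simp
  \<comment> \<open>With \<open>w = K - e\<close>, the bound on \<open>W\<close> falls short of
    \<open>a * b * K\<close> by exactly the nonnegative quantity just found.\<close>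
  moreover have "(a * b + e) * w = a * b * K - (e * (a * b - K) + e * e)"
    using ew(3)[symmetric] by (simp add: algebra_simps)
  ultimately show "2 * W \<le> a * b * (2 * K)"
    using ew(4) by linarith
  \<comment> \<open>For \<open>x = (1 - a) * b\<close> and \<open>y = (1 - b) * a\<close> this is
    \<open>K^2 \<le> x * y\<close> combined with \<open>4 * x * y = (x + y)^2 - (x - y)^2\<close>.
    The last square is kept because it forces \<open>a = b\<close> in the equality case.\<close>
  show sq: "(2 * K)\<^sup>2 \<le> ((1 - a) * b + (1 - b) * a)\<^sup>2 - ((1 - a) * b - (1 - b) * a)\<^sup>2"
    using K_squared_le by (simp add: power2_eq_square algebra_simps)
  have "(2 * K)\<^sup>2 \<le> ((1 - a) * b + (1 - b) * a)\<^sup>2"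
    using sq by (rule order.trans) simp
  then have "2 * K \<le> (1 - a) * b + (1 - b) * a"
    using ab_bounds by (intro power2_le_imp_le[of "2 * K"]) auto
  then show "a * b * (2 * K) \<le> a * b * ((1 - a) * b + (1 - b) * a)"
    using ab by (rule mult_left_mono)
qed

text \<open>Expansion of \<open>a * b * (a + (1 - a)) * (b + (1 - b))\<close>. If
  \<open>1 \<le> a + b\<close>, the three summands account in turn for the empty set in
  \<open>quartic_form\<close>, for \<open>Q\<close> and for \<open>2 * W\<close>.\<close>

lemma ab_split: "a * b = (a * b)\<^sup>2 + (a * (1 - a)) * (b * (1 - b)) + a * b * ((1 - a) * b + (1 - b) * a)"
  by (simp add: power2_eq_square algebra_simps)

text \<open>By \<open>M_ge\<close> it suffices that
  \<open>quartic_form V F G + 2 * W \<le> a * b\<close>. This is \<open>quartic_form_W_less\<close>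
  if \<open>a + b < 1\<close> and a termwise comparison with \<open>ab_split\<close> otherwise; zero
  means are treated apart because the strict bound asks for positive ones.\<close>

lemma quartic_form_le_ab_plus_M: "quartic_form V F G \<le> a * b + M"
proof (cases "a = 0 \<or> b = 0")
  case True
  then have "K = 0" using total_squared_le by auto
  obtain e w where "0 \<le> e" "0 \<le> w" "e + w = K" "W \<le> (a * b + e) * w"
    by (rule W_le)
  then have "W \<le> 0" using \<open>K = 0\<close> by (simp add: add_nonneg_eq_0_iff)
  then show ?thesis using True quartic_form_le M_ge W_nonneg by auto
next
  case False
  then have pos: "0 < a" "0 < b" using ab_bounds by auto
  show ?thesis
  proof (cases "a + b < 1")
    case True
    then show ?thesis using quartic_form_W_less[OF _ pos] M_ge by linarith
  next
    case False
    then show ?thesis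
      using two_W_le quartic_form_eq Q_le K_squared_le ab_split M_ge by linarith
  qed
qed

text \<open>
  Equality forces \<open>(\<Sum>S\<noteq>{}. k S\<^sup>2) = (\<Sum>S\<noteq>{}. k S)\<^sup>2\<close>, so a single nonempty \<open>S\<close> has \<open>k S \<noteq> 0\<close>,
  and \<open>W \<noteq> 0\<close> makes it adjacent to \<open>{}\<close>.
\<close>

lemma equality_case:
  assumes eq: "a * b + M = quartic_form V F G" and pos: "0 < a" "0 < b"
  shows "(a = 1 \<and> b = 1) \<or> (\<exists>j\<in>V. a = b \<and> a < 1 \<and> (hat V F {j})\<^sup>2 = a * (1 - a)
    \<and> (hat V G {j})\<^sup>2 = b * (1 - b) \<and> hat V F {j} * hat V G {j} < 0)"
proof -
  have ab: "0 < a * b" using pos by simp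
  have ge: "1 \<le> a + b"
    using quartic_form_W_less[OF _ pos] M_ge eq by linarith
  let ?t = "(1 - a) * b + (1 - b) * a"
  \<comment> \<open>Equality collapses the whole chain of estimates, so each of them is
    tight.\<close>
  have Q: "Q = K\<^sup>2" "K\<^sup>2 = (a * (1 - a)) * (b * (1 - b))"
    and W: "M = - 2 * W" "2 * W = a * b * (2 * K)" "a * b * (2 * K) = a * b * ?t"
    using two_W_le[OF ge] quartic_form_eq Q_le K_squared_le ab_split M_ge eq by linarith+
  have K: "2 * K = ?t"
    using W(3) pos by simp
  \<comment> \<open>The square kept in \<open>two_W_le\<close> must vanish, and its base is
    \<open>b - a\<close>.\<close>
  have "((1 - a) * b - (1 - b) * a)\<^sup>2 \<le> 0"
    using two_W_le(3)[OF ge] unfolding K by linarith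
  then have "a = b" by (simp add: algebra_simps)
  show ?thesis
  proof (cases "K = 0")
    case True
    then have "(1 - a) * b = 0" using \<open>a = b\<close> K by auto
    then show ?thesis using pos \<open>a = b\<close> by auto
  next
    case False
    then have "0 < K" using K_nonneg by simp
    then have "0 < a * b * (2 * K)" using ab \<open>0 < K\<close> by (metis mult_pos_pos zero_less_numeral)
    then have "0 < W" using W(2) by linarith
    \<comment> \<open>\<open>W > 0\<close> provides an edge with \<open>k\<close> nonzero at both
      ends. Only one nonempty set has \<open>k\<close> nonzero, so the lower end will turn out to be
      empty.\<close>
    then obtain j S where j: "j \<in> V" "S \<in> Pow (V - {j})" "k S * k (insert j S) \<noteq> 0"
      unfolding W_def by (metis (no_types, lifting) less_irrefl sum.neutral)
    have uniq: "k T = 0" if "T \<in> Pow V - {{}}" "T \<noteq> insert j S" for T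
      using sum_squares_eq_square_sum[of "Pow V - {{}}" k "insert j S" T] that j k_nonneg fin Q(1)
      unfolding Q_def K_def by (auto simp: less_le)
    have "S = {}"
      using uniq[of S] j by auto
    have "K = k {j}"
      using uniq j fin unfolding \<open>S = {}\<close> K_def
      by (subst sum.remove[of _ "{j}"]) (auto intro!: sum.neutral)
    have le: "(hat V F {j})\<^sup>2 \<le> a * (1 - a)" "(hat V G {j})\<^sup>2 \<le> b * (1 - b)"
      unfolding sum_hat_squares_nonempty[symmetric] using j(1) fin
      by (auto intro!: member_le_sum)
    \<comment> \<open>All of \<open>K\<close> sits at \<open>{j}\<close>. Each squared coefficient
      is at most its variance while their product attains the product of the variances, so both are
      maximal.\<close>
    have prod: "(hat V F {j})\<^sup>2 * (hat V G {j})\<^sup>2 = (a * (1 - a)) * (b * (1 - b))"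
      using Q(2) unfolding \<open>K = k {j}\<close> k_def by (simp add: power_mult_distrib)
    have pos': "0 < (a * (1 - a)) * (b * (1 - b))"
      using Q(2) \<open>0 < K\<close> by (metis zero_less_power)
    have "a < 1" using pos' ab_bounds \<open>a = b\<close> by (auto simp: less_le)
    then have pos'': "0 < a * (1 - a)" "0 < b * (1 - b)" using pos \<open>a = b\<close> by auto
    have sq: "(hat V F {j})\<^sup>2 = a * (1 - a)" "(hat V G {j})\<^sup>2 = b * (1 - b)"
    proof -
      show "(hat V F {j})\<^sup>2 = a * (1 - a)"
      proof (rule ccontr)
        assume "(hat V F {j})\<^sup>2 \<noteq> a * (1 - a)"
        then have "(hat V F {j})\<^sup>2 * (b * (1 - b)) < (a * (1 - a)) * (b * (1 - b))"
          using le pos'' by (intro mult_strict_right_mono) auto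
        moreover have "(hat V F {j})\<^sup>2 * (hat V G {j})\<^sup>2 \<le> (hat V F {j})\<^sup>2 * (b * (1 - b))"
          using le by (intro mult_left_mono) auto
        ultimately show False using prod by linarith
      qed
      then show "(hat V G {j})\<^sup>2 = b * (1 - b)" using prod pos'' by auto
    qed
    have "hat V F {j} * hat V G {j} \<noteq> 0"
      using sq pos'' by auto
    \<comment> \<open>A positive product would lift the edge at the empty set strictly above its
      lower bound, against \<open>M = - 2 * W\<close>.\<close>
    moreover have "\<not> 0 < hat V F {j} * hat V G {j}"
    proof
      assume "0 < hat V F {j} * hat V G {j}"
      then have "- 2 * (k {} * k (insert j {})) < edge V F G j {}"
        using ab by (intro edge_gt) (simp add: mult_pos_pos)
      then have "(\<Sum>S\<in>Pow (V - {j}). - 2 * (k S * k (insert j S))) < (\<Sum>S\<in>Pow (V - {j}). edge V F G j S)"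
        using fin by (intro sum_strict_mono_ex1) (auto intro!: bexI[of _ "{}"] edge_ge[simplified])
      then have "(\<Sum>j\<in>V. \<Sum>S\<in>Pow (V - {j}). - 2 * (k S * k (insert j S))) < M"
        unfolding M_def using fin j(1)
        by (intro sum_strict_mono_ex1) (auto intro!: bexI[of _ j] sum_mono edge_ge[simplified])
      then show False
        using W(1) by (simp add: W_def sum_distrib_left)
    qed
    ultimately show ?thesis
      using sq \<open>a = b\<close> \<open>a < 1\<close> j(1) by (meson linorder_less_linear)
  qed
qed

end

section \<open>Induction on the dimension\<close>

lemma boolean_restrict:
  assumes "boolean V F" "j \<in> V"
  shows "boolean (V - {j}) F" "boolean (V - {j}) (\<lambda>X. F (insert j X))"
proof -
  show "boolean (V - {j}) F"
    using assms(1) unfolding boolean_def by blast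
  show "boolean (V - {j}) (\<lambda>X. F (insert j X))"
    unfolding boolean_def
  proof (intro allI impI)
    fix X assume "X \<subseteq> V - {j}"
    then have "insert j X \<subseteq> V" using assms(2) by auto
    then show "F (insert j X) \<in> {0, 1}" using assms(1) by (simp add: boolean_def)
  qed
qed

text \<open>One step of the induction on \<open>card V\<close>, keeping the slack needed for the equality case.\<close>

lemma quartic_le_noise_form_step:
  assumes "finite V" "boolean V F" "boolean V G"
    and IH: "\<And>j F G. j \<in> V \<Longrightarrow> boolean (V - {j}) F \<Longrightarrow> boolean (V - {j}) G \<Longrightarrow> quartic_form (V - {j}) F G \<le> noise_form (V - {j}) F G"
  shows "hat V F {} * hat V G {} + boolean_pair.M V F G - quartic_form V F G
    \<le> (real (card V) + 1) * (noise_form V F G - quartic_form V F G)"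
proof -
  interpret boolean_pair V F G
    using assms(1-3) by unfold_locales
  have "(\<Sum>j\<in>V. (quartic_form (V - {j}) F G + quartic_form (V - {j}) (\<lambda>X. F (insert j X)) (\<lambda>X. G (insert j X))) / 2)
      \<le> (\<Sum>j\<in>V. (noise_form (V - {j}) F G + noise_form (V - {j}) (\<lambda>X. F (insert j X)) (\<lambda>X. G (insert j X))) / 2)"
    using assms(2,3) by (intro sum_mono divide_right_mono add_mono IH boolean_restrict) auto
  then show ?thesis
    using noise_form_recurrence[OF assms(1), of F G] quartic_form_average[OF assms(1), of F G]
    unfolding M_def by (simp add: algebra_simps)
qed

text \<open>The step bounds \<open>(card V + 1)\<close> times the gap from below by
  \<open>a * b + M - quartic_form V F G\<close>, which \<open>quartic_form_le_ab_plus_M\<close>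
  makes nonnegative.\<close>

lemma quartic_le_noise_form:
  assumes "finite V" "boolean V F" "boolean V G"
  shows "quartic_form V F G \<le> noise_form V F G"
  using assms
proof (induction "card V" arbitrary: V F G)
  case 0
  then show ?case
    using quartic_le_noise_form_step[of V F G] boolean_pair.quartic_form_le_ab_plus_M[of V F G]
    by (simp add: boolean_pair_def)
next
  case (Suc m)
  have "quartic_form (V - {j}) F' G' \<le> noise_form (V - {j}) F' G'"
    if "j \<in> V" "boolean (V - {j}) F'" "boolean (V - {j}) G'" for j F' G'
    using Suc.hyps(1)[of "V - {j}" F' G'] Suc.hyps(2) Suc.prems(1) that by simp
  from quartic_le_noise_form_step[OF Suc.prems this] boolean_pair.quartic_form_le_ab_plus_M[of V F G] Suc.prems
  have "0 \<le> (real (card V) + 1) * (noise_form V F G - quartic_form V F G)"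
    unfolding boolean_pair_def by fastforce
  then show ?case by (simp add: zero_le_mult_iff)
qed

section \<open>Equality cases for Boolean pairs\<close>

lemma hat_const: "finite V \<Longrightarrow> hat V (\<lambda>_. c) {} = c"
  by (simp add: hat_empty card_Pow)

lemma boolean_mean_0:
  assumes "finite V" "boolean V F" "hat V F {} = 0" "X \<subseteq> V"
  shows "F X = 0"
proof -
  have "(\<Sum>X\<in>Pow V. F X) = 0"
    using assms(3) by (simp add: hat_empty)
  moreover have "\<forall>X\<in>Pow V. 0 \<le> F X"
    using assms(2) by (auto simp: boolean_def)
  ultimately show ?thesis
    using assms(1,4) sum_nonneg_eq_0_iff[of "Pow V" F] by auto
qed

lemma boolean_mean_1:
  assumes "finite V" "boolean V F" "hat V F {} = 1" "X \<subseteq> V"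
  shows "F X = 1"
proof -
  have "boolean V (\<lambda>X. 1 - F X)"
    using assms(2) by (auto simp: boolean_def)
  moreover have "hat V (\<lambda>X. 1 - F X) {} = 0"
    using hat_diff[of V "\<lambda>_. 1" F "{}"] hat_const[OF assms(1), of 1] assms(3) by simp
  ultimately show ?thesis
    using boolean_mean_0[OF assms(1) _ _ assms(4), of "\<lambda>X. 1 - F X"] by simp
qed

text \<open>In the facet means \<open>m0\<close>, \<open>m1\<close> the hypothesis \<open>sq\<close>
  reads \<open>m0 * (1 - m0) + m1 * (1 - m1) = 0\<close>. So \<open>F\<close> is constant on each
  facet, and the sign of \<open>hat V F {j} = (m0 - m1) / 2\<close> tells which constants
  occur.\<close>

lemma boolean_dictator:
  assumes "finite V" "boolean V F" "j \<in> V"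
    and sq: "(hat V F {j})\<^sup>2 = hat V F {} * (1 - hat V F {})"
  shows "hat V F {j} < 0 \<Longrightarrow> X \<subseteq> V \<Longrightarrow> F X = of_bool (j \<in> X)"
    and "0 < hat V F {j} \<Longrightarrow> X \<subseteq> V \<Longrightarrow> F X = of_bool (j \<notin> X)"
proof -
  define m0 m1 where "m0 = hat (V - {j}) F {}" and "m1 = hat (V - {j}) (\<lambda>X. F (insert j X)) {}"
  have h: "hat V F {} = (m0 + m1) / 2" "hat V F {j} = (m0 - m1) / 2"
    using hat_remove[OF assms(1,3), of "{}" F] by (simp_all add: m0_def m1_def)
  note br = boolean_restrict[OF assms(2,3)]
  have fin: "finite (V - {j})" using assms(1) by simp
  have bd: "0 \<le> m0" "m0 \<le> 1" "0 \<le> m1" "m1 \<le> 1"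
    using boolean_hat[OF fin br(1)] boolean_hat[OF fin br(2)] by (auto simp: m0_def m1_def)
  have "m0 * (1 - m0) + m1 * (1 - m1) = 0"
    using sq unfolding h by (simp add: power2_eq_square field_simps)
  moreover have "0 \<le> m0 * (1 - m0)" "0 \<le> m1 * (1 - m1)"
    using bd by auto
  ultimately have "m0 * (1 - m0) = 0" "m1 * (1 - m1) = 0"
    by linarith+
  then have m: "m0 = 0 \<or> m0 = 1" "m1 = 0 \<or> m1 = 1"
    by auto
  have val: "F X = (if j \<in> X then m1 else m0)" if "X \<subseteq> V" for X
  proof (cases "j \<in> X")
    case True
    then have X: "insert j (X - {j}) = X" "X - {j} \<subseteq> V - {j}"
      using that by auto
    have "F (insert j (X - {j})) = m1"
      using boolean_mean_0[OF fin br(2) _ X(2)] boolean_mean_1[OF fin br(2) _ X(2)] m(2)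
      by (auto simp: m1_def)
    then show ?thesis using True X by simp
  next
    case False
    then have X: "X \<subseteq> V - {j}"
      using that by auto
    then show ?thesis
      using boolean_mean_0[OF fin br(1) _ X] boolean_mean_1[OF fin br(1) _ X] m(1) False
      by (auto simp: m0_def)
  qed
  show "F X = of_bool (j \<in> X)" if "hat V F {j} < 0" "X \<subseteq> V"
    using that m by (auto simp: h val)
  show "F X = of_bool (j \<notin> X)" if "0 < hat V F {j}" "X \<subseteq> V"
    using that m by (auto simp: h val)
qed

text \<open>The sets in \<open>A\<close> already exhaust the Parseval sum.\<close>

lemma hat_eq_0:
  assumes "finite V" "boolean V F" "A \<subseteq> Pow V" "(\<Sum>S\<in>A. (hat V F S)\<^sup>2) = hat V F {}"
    and "S \<in> Pow V - A"
  shows "hat V F S = 0"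
proof -
  have "(\<Sum>S\<in>Pow V - A. (hat V F S)\<^sup>2) = 0"
    using sum_hat_squares[OF assms(1,2)] assms(1,3,4) by (simp add: sum_diff)
  then show ?thesis
    using assms(1,5) sum_nonneg_eq_0_iff[of "Pow V - A" "\<lambda>S. (hat V F S)\<^sup>2"] by auto
qed

lemma boolean_one_hat:
  assumes "finite V" "\<And>X. X \<subseteq> V \<Longrightarrow> F X = 1"
  shows "hat V F {} = 1" and "S \<in> Pow V - {{}} \<Longrightarrow> hat V F S = 0"
proof -
  have b: "boolean V F" using assms(2) by (simp add: boolean_def)
  show "hat V F {} = 1"
    using hat_cong[of V F "\<lambda>_. 1" "{}"] assms by (simp add: hat_const)
  then show "S \<in> Pow V - {{}} \<Longrightarrow> hat V F S = 0"
    using hat_eq_0[OF assms(1) b, of "{{}}" S] by simp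
qed

text \<open>\<open>c\<close> is the value on the facet containing \<open>j\<close>:
  \<open>c = 1\<close> is the coordinate function and \<open>c = 0\<close> its negation. The
  coefficients at \<open>{}\<close> and \<open>{j}\<close> use up the Parseval sum,
  \<open>1/4 + 1/4 = 1/2\<close>.\<close>

lemma boolean_dictator_hat:
  assumes "finite V" "j \<in> V" "c = 0 \<or> c = 1" "\<And>X. X \<subseteq> V \<Longrightarrow> F X = (if j \<in> X then c else 1 - c)"
  shows "hat V F {} = 1 / 2" "hat V F {j} = 1 / 2 - c" and "S \<in> Pow V - {{}, {j}} \<Longrightarrow> hat V F S = 0"
proof -
  have b: "boolean V F" using assms(3,4) by (auto simp: boolean_def)
  have F: "F X = 1 - c" "F (insert j X) = c" if "X \<subseteq> V - {j}" for X
  proof -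
    have "X \<subseteq> V" "insert j X \<subseteq> V" "j \<notin> X" using that assms(2) by auto
    then show "F X = 1 - c" "F (insert j X) = c" by (simp_all add: assms(4))
  qed
  have "hat (V - {j}) F {} = 1 - c"
    using hat_cong[of "V - {j}" F "\<lambda>_. 1 - c" "{}"] F(1) assms(1) by (simp add: hat_const)
  moreover have "hat (V - {j}) (\<lambda>X. F (insert j X)) {} = c"
    using hat_cong[of "V - {j}" "\<lambda>X. F (insert j X)" "\<lambda>_. c" "{}"] F(2) assms(1) by (simp add: hat_const)
  ultimately show h: "hat V F {} = 1 / 2" "hat V F {j} = 1 / 2 - c"
    using hat_remove[OF assms(1,2), of "{}" F] by (simp_all add: field_simps)
  show "hat V F S = 0" if "S \<in> Pow V - {{}, {j}}"
  proof (rule hat_eq_0[OF assms(1) b _ _ that])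
    show "(\<Sum>S\<in>{{}, {j}}. (hat V F S)\<^sup>2) = hat V F {}"
      using assms(3) by (auto simp: h power2_eq_square)
  qed (use assms in auto)
qed

lemma forms_commute: "noise_form V F G = noise_form V G F" "quartic_form V F G = quartic_form V G F"
  by (simp_all add: noise_form_def quartic_form_def mult.commute)

text \<open>Only \<open>{}\<close> and \<open>{j}\<close> contribute, and both forms equal
  \<open>1/8\<close>: as \<open>1/4 - 1/4 * 1/2\<close> and as \<open>1/16 + 1/16\<close>.\<close>

lemma noise_eq_quartic_form_opposite:
  assumes "finite V" "j \<in> V" "\<And>X. X \<subseteq> V \<Longrightarrow> F X = of_bool (j \<in> X) \<and> G X = of_bool (j \<notin> X)"
  shows "noise_form V F G = quartic_form V F G"
proof -
  have F: "hat V F {} = 1 / 2" "hat V F {j} = - 1 / 2" "S \<in> Pow V - {{}, {j}} \<Longrightarrow> hat V F S = 0" for S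
    using boolean_dictator_hat(1,2)[OF assms(1,2), of 1 F]
      boolean_dictator_hat(3)[OF assms(1,2), of 1 F S] assms(3) by simp_all
  have G: "hat V G {} = 1 / 2" "hat V G {j} = 1 / 2"
    using boolean_dictator_hat(1,2)[OF assms(1,2), of 0 G] assms(3) by simp_all
  have "noise_form V F G = (\<Sum>S\<in>{{}, {j}}. hat V F S * hat V G S / (real (card S) + 1))"
    unfolding noise_form_def using assms(1,2) F(3) by (intro sum.mono_neutral_right) auto
  moreover have "quartic_form V F G = (\<Sum>S\<in>{{}, {j}}. (hat V F S)\<^sup>2 * (hat V G S)\<^sup>2)"
    unfolding quartic_form_def using assms(1,2) F(3) by (intro sum.mono_neutral_right) auto
  ultimately show ?thesis
    by (simp add: F(1,2) G power2_eq_square)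
qed

text \<open>Equality of the forms makes the upper bound in the induction step zero, hence
  \<open>a * b + M = quartic_form V F G\<close> on \<open>V\<close> itself;
  \<open>equality_case\<close> then applies without descending to facets.\<close>

lemma noise_eq_quartic_form_iff:
  assumes "finite V" "boolean V F" "boolean V G"
  shows "noise_form V F G = quartic_form V F G \<longleftrightarrow>
      (\<forall>X\<subseteq>V. F X = 0) \<or> (\<forall>X\<subseteq>V. G X = 0) \<or> (\<forall>X\<subseteq>V. F X = 1 \<and> G X = 1)
    \<or> (\<exists>j\<in>V. (\<forall>X\<subseteq>V. F X = of_bool (j \<in> X) \<and> G X = of_bool (j \<notin> X))
           \<or> (\<forall>X\<subseteq>V. G X = of_bool (j \<in> X) \<and> F X = of_bool (j \<notin> X)))"
    (is "?L \<longleftrightarrow> ?R")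
proof
  interpret boolean_pair V F G
    using assms by unfold_locales
  assume ?L
  moreover have "a * b + M - quartic_form V F G \<le> (real (card V) + 1) * (noise_form V F G - quartic_form V F G)"
    using assms by (intro quartic_le_noise_form_step quartic_le_noise_form) auto
  ultimately have "a * b + M = quartic_form V F G"
    using quartic_form_le_ab_plus_M by simp
  show ?R
  proof (cases "a = 0 \<or> b = 0")
    case True
    then show ?thesis
      using boolean_mean_0[OF assms(1)] assms(2,3) by blast
  next
    case False
    then have "0 < a" "0 < b" using ab_bounds by auto
    from equality_case[OF \<open>a * b + M = quartic_form V F G\<close> this] show ?thesis
    proof (elim disjE conjE bexE)
      assume "a = 1" "b = 1"
      then show ?thesis
        using boolean_mean_1[OF assms(1)] assms(2,3) by blast
    next
      fix j assume j: "j \<in> V" "(hat V F {j})\<^sup>2 = a * (1 - a)" "(hat V G {j})\<^sup>2 = b * (1 - b)"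
        and "hat V F {j} * hat V G {j} < 0"
      then consider "hat V F {j} < 0" "0 < hat V G {j}" | "0 < hat V F {j}" "hat V G {j} < 0"
        by (auto simp: mult_less_0_iff)
      then show ?thesis
        using boolean_dictator[OF assms(1,2) j(1,2)] boolean_dictator[OF assms(1,3) j(1,3)] j(1)
        by cases blast+
    qed
  qed
next
  assume ?R
  then consider "\<forall>X\<subseteq>V. F X = 0" | "\<forall>X\<subseteq>V. G X = 0" | "\<forall>X\<subseteq>V. F X = 1 \<and> G X = 1"
    | j where "j \<in> V" "\<forall>X\<subseteq>V. F X = of_bool (j \<in> X) \<and> G X = of_bool (j \<notin> X)"
    | j where "j \<in> V" "\<forall>X\<subseteq>V. G X = of_bool (j \<in> X) \<and> F X = of_bool (j \<notin> X)"
    by blast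
  then show ?L
  proof cases
    case 1
    then show ?thesis by (simp add: noise_form_def quartic_form_def hat_def)
  next
    case 2
    then show ?thesis by (simp add: noise_form_def quartic_form_def hat_def)
  next
    case 3
    then have F: "hat V F {} = 1" "S \<in> Pow V - {{}} \<Longrightarrow> hat V F S = 0" and G: "hat V G {} = 1" for S
      using boolean_one_hat(1)[OF assms(1), of F] boolean_one_hat(2)[OF assms(1), of F S]
        boolean_one_hat(1)[OF assms(1), of G] by simp_all
    have "noise_form V F G = (\<Sum>S\<in>{{}}. hat V F S * hat V G S / (real (card S) + 1))"
      unfolding noise_form_def using assms(1) F(2) by (intro sum.mono_neutral_right) auto
    moreover have "quartic_form V F G = (\<Sum>S\<in>{{}}. (hat V F S)\<^sup>2 * (hat V G S)\<^sup>2)"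
      unfolding quartic_form_def using assms(1) F(2) by (intro sum.mono_neutral_right) auto
    ultimately show ?thesis by (simp add: F(1) G)
  next
    case 4
    then show ?thesis by (intro noise_eq_quartic_form_opposite[OF assms(1)]) auto
  next
    case 5
    then have "noise_form V G F = quartic_form V G F" by (intro noise_eq_quartic_form_opposite[OF assms(1)]) auto
    then show ?thesis by (simp add: forms_commute[of V F G])
  qed
qed

section \<open>Covariance through discrete derivatives\<close>

definition jump :: "'a \<Rightarrow> ('a set \<Rightarrow> real) \<Rightarrow> 'a set \<Rightarrow> real" where
  "jump j F X = F (insert j X) - F X"

lemma hat_insert_jump:
  assumes "finite V" "j \<in> V" "j \<notin> S"
  shows "hat V F (insert j S) = - hat (V - {j}) (jump j F) S / 2"
  unfolding hat_remove(2)[OF assms] jump_def[abs_def] hat_diff by simp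

text \<open>Parseval writes the covariance as a sum over nonempty \<open>T\<close>, and each term is
  shared equally among the \<open>card T\<close> elements of \<open>T\<close>. The share
  \<open>1 / card (insert j S)\<close> is the weight in \<open>noise_form\<close>, and the two
  factors \<open>- 1 / 2\<close> from \<open>hat_insert_jump\<close> give the
  \<open>1 / 4\<close>.\<close>

lemma covariance_eq_sum_noise_form:
  assumes "finite V"
  shows "hat V (\<lambda>X. F X * G X) {} - hat V F {} * hat V G {}
    = (\<Sum>j\<in>V. noise_form (V - {j}) (jump j F) (jump j G)) / 4"
proof -
  define h where "h S = hat V F S * hat V G S" for S
  have "hat V (\<lambda>X. F X * G X) {} - h {} = (\<Sum>S\<in>Pow V. h S) - h {}"
    using parseval[OF assms, of F G] by (simp add: h_def)
  also have "\<dots> = (\<Sum>S\<in>Pow V - {{}}. h S)"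
    using assms by (simp add: sum.remove[of "Pow V" "{}"])
  also have "\<dots> = (\<Sum>S\<in>Pow V. card S * (h S / card S))"
    using assms by (intro sum.mono_neutral_cong_left) (auto simp: finite_subset)
  also have "\<dots> = (\<Sum>j\<in>V. \<Sum>S\<in>Pow (V - {j}). h (insert j S) / card (insert j S))"
    using sum_remove_Pow_insert[OF assms, of "\<lambda>S. h S / card S"] by simp
  also have "\<dots> = (\<Sum>j\<in>V. noise_form (V - {j}) (jump j F) (jump j G) / 4)"
    unfolding noise_form_def sum_divide_distrib
  proof (intro sum.cong refl)
    fix j S assume "j \<in> V" "S \<in> Pow (V - {j})"
    then have "j \<notin> S" "finite S" using assms finite_subset by auto
    then show "h (insert j S) / card (insert j S)
        = hat (V - {j}) (jump j F) S * hat (V - {j}) (jump j G) S / (real (card S) + 1) / 4"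
      unfolding h_def hat_insert_jump[OF assms \<open>j \<in> V\<close> \<open>j \<notin> S\<close>] by simp
  qed
  finally show ?thesis
    by (simp add: h_def sum_divide_distrib)
qed

text \<open>The weight \<open>card S\<close> is itself a count of the elements of \<open>S\<close>.
  Four factors \<open>1 / 2\<close> against the leading \<open>4\<close> leave the same
  \<open>1 / 4\<close> as for the covariance.\<close>

lemma weighted_sum_eq_sum_quartic_form:
  assumes "finite V"
  shows "4 * (\<Sum>S\<in>Pow V - {{}}. real (card S) * (hat V F S)\<^sup>2 * (hat V G S)\<^sup>2)
    = (\<Sum>j\<in>V. quartic_form (V - {j}) (jump j F) (jump j G)) / 4"
proof -
  define h where "h S = (hat V F S)\<^sup>2 * (hat V G S)\<^sup>2" for S
  have "(\<Sum>S\<in>Pow V - {{}}. card S * h S) = (\<Sum>S\<in>Pow V. card S * h S)"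
    using assms by (intro sum.mono_neutral_left) auto
  also have "\<dots> = (\<Sum>j\<in>V. \<Sum>S\<in>Pow (V - {j}). h (insert j S))"
    using sum_remove_Pow_insert[OF assms, of h] by simp
  also have "\<dots> = (\<Sum>j\<in>V. quartic_form (V - {j}) (jump j F) (jump j G) / 16)"
    unfolding quartic_form_def sum_divide_distrib
  proof (intro sum.cong refl)
    fix j S assume "j \<in> V" "S \<in> Pow (V - {j})"
    then have "j \<notin> S" by auto
    then show "h (insert j S) = (hat (V - {j}) (jump j F) S)\<^sup>2 * (hat (V - {j}) (jump j G) S)\<^sup>2 / 16"
      unfolding h_def hat_insert_jump[OF assms \<open>j \<in> V\<close> \<open>j \<notin> S\<close>] by (simp add: power2_eq_square)
  qed
  finally show ?thesis
    by (simp add: h_def mult.assoc sum_divide_distrib[symmetric])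
qed

definition increasing_on :: "'a set \<Rightarrow> ('a set \<Rightarrow> real) \<Rightarrow> bool" where
  "increasing_on V F \<longleftrightarrow> (\<forall>X Y. X \<subseteq> Y \<longrightarrow> Y \<subseteq> V \<longrightarrow> F X \<le> F Y)"

lemma increasing_onD: "increasing_on V F \<Longrightarrow> X \<subseteq> Y \<Longrightarrow> Y \<subseteq> V \<Longrightarrow> F X \<le> F Y"
  by (simp add: increasing_on_def)

text \<open>Monotonicity excludes the value \<open>-1\<close>, which brings derivatives within reach
  of the Boolean inequality.\<close>

lemma boolean_jump:
  assumes "boolean V F" "increasing_on V F" "j \<in> V"
  shows "boolean (V - {j}) (jump j F)"
  unfolding boolean_def
proof (intro allI impI)
  fix X assume "X \<subseteq> V - {j}"
  then have "X \<subseteq> V" "insert j X \<subseteq> V" using assms(3) by auto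
  then have "F X \<in> {0, 1}" "F (insert j X) \<in> {0, 1}" "F X \<le> F (insert j X)"
    using assms(1,2) by (auto simp: boolean_def increasing_on_def subset_insertI)
  then show "jump j F X \<in> {0, 1}" by (auto simp: jump_def)
qed

section \<open>Recovering the functions from their derivatives\<close>

definition and_or :: "'a set \<Rightarrow> 'a \<Rightarrow> 'a \<Rightarrow> ('a set \<Rightarrow> real) \<Rightarrow> ('a set \<Rightarrow> real) \<Rightarrow> bool" where
  "and_or V i j F G \<longleftrightarrow> (\<forall>X\<subseteq>V. F X = of_bool (i \<in> X \<and> j \<in> X) \<and> G X = of_bool (i \<in> X \<or> j \<in> X))"

lemma subset_cases:
  assumes "X \<subseteq> V" "i \<in> V"
  obtains (without) "X \<subseteq> V - {i}" | (insert) Y where "X = insert i Y" "Y \<subseteq> V - {i}" "i \<notin> Y"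
proof (cases "i \<in> X")
  case True
  then have "X = insert i (X - {i})" "X - {i} \<subseteq> V - {i}" "i \<notin> X - {i}" using assms by auto
  then show thesis by (rule insert)
qed (use assms without in blast)

lemma jump_one:
  assumes "boolean V F" "i \<in> V" "\<forall>X\<subseteq>V - {i}. jump i F X = 1" "X \<subseteq> V"
  shows "F X = of_bool (i \<in> X)"
proof -
  have F: "F Y = 0" "F (insert i Y) = 1" if "Y \<subseteq> V - {i}" for Y
  proof -
    have "Y \<subseteq> V" "insert i Y \<subseteq> V" using that assms(2) by auto
    then have "F Y \<in> {0, 1}" "F (insert i Y) \<in> {0, 1}"
      using assms(1) by (auto simp: boolean_def)
    moreover have "F (insert i Y) - F Y = 1"
      using assms(3) that by (simp add: jump_def)
    ultimately show "F Y = 0" "F (insert i Y) = 1" by auto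
  qed
  from assms(4,2) show ?thesis
    by (cases rule: subset_cases) (auto simp: F)
qed

text \<open>Where a jump is \<open>1\<close>, both values are determined. Where it is
  \<open>0\<close>, monotonicity decides: \<open>F\<close> vanishes without \<open>j\<close> because
  it vanishes at \<open>insert j Y\<close>, and \<open>G\<close> is \<open>1\<close> with
  \<open>j\<close> because it is \<open>1\<close> at \<open>insert i (Y - {j})\<close>.\<close>

lemma jump_and_or:
  assumes "boolean V F" "boolean V G" "increasing_on V F" "increasing_on V G" "i \<in> V" "j \<in> V - {i}"
    and jump: "\<forall>X\<subseteq>V - {i}. jump i F X = of_bool (j \<in> X) \<and> jump i G X = of_bool (j \<notin> X)"
  shows "and_or V i j F G"
proof -
  have bool: "F Y \<in> {0, 1}" "F (insert i Y) \<in> {0, 1}" "G Y \<in> {0, 1}" "G (insert i Y) \<in> {0, 1}"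
    if "Y \<subseteq> V - {i}" for Y
  proof -
    have "Y \<subseteq> V" "insert i Y \<subseteq> V" using that assms(5) by auto
    then show "F Y \<in> {0, 1}" "F (insert i Y) \<in> {0, 1}" "G Y \<in> {0, 1}" "G (insert i Y) \<in> {0, 1}"
      using assms(1,2) by (auto simp: boolean_def)
  qed
  have F1: "F Y = 0 \<and> F (insert i Y) = 1" if "Y \<subseteq> V - {i}" "j \<in> Y" for Y
    using jump[rule_format, OF that(1)] bool[OF that(1)] that(2) by (auto simp: jump_def)
  have G1: "G Y = 0 \<and> G (insert i Y) = 1" if "Y \<subseteq> V - {i}" "j \<notin> Y" for Y
    using jump[rule_format, OF that(1)] bool[OF that(1)] that(2) by (auto simp: jump_def)
  have F0: "F Y = 0 \<and> F (insert i Y) = 0" if "Y \<subseteq> V - {i}" "j \<notin> Y" for Y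
  proof -
    have Y: "insert j Y \<subseteq> V - {i}" "insert j Y \<subseteq> V" using that assms(6) by auto
    have "F Y \<le> F (insert j Y)"
      using Y(2) by (intro increasing_onD[OF assms(3)]) auto
    then have "F Y = 0" using F1[OF Y(1)] bool[OF that(1)] by auto
    then show ?thesis using jump[rule_format, OF that(1)] that(2) by (auto simp: jump_def)
  qed
  have G0: "G Y = 1 \<and> G (insert i Y) = 1" if "Y \<subseteq> V - {i}" "j \<in> Y" for Y
  proof -
    have Y: "Y - {j} \<subseteq> V - {i}" "insert i Y \<subseteq> V" using that assms(5) by auto
    have "G (insert i (Y - {j})) \<le> G (insert i Y)"
      using Y(2) by (intro increasing_onD[OF assms(4)]) auto
    then have "G (insert i Y) = 1" using G1[OF Y(1)] bool[OF that(1)] by auto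
    then show ?thesis using jump[rule_format, OF that(1)] that(2) by (auto simp: jump_def)
  qed
  show ?thesis
    unfolding and_or_def
  proof (intro allI impI)
    fix X assume "X \<subseteq> V"
    from this assms(5) show "F X = of_bool (i \<in> X \<and> j \<in> X) \<and> G X = of_bool (i \<in> X \<or> j \<in> X)"
    proof (cases rule: subset_cases)
      case without
      then have "i \<notin> X" by auto
      then show ?thesis using F0[OF without] F1[OF without] G0[OF without] G1[OF without]
        by (cases "j \<in> X") auto
    next
      case (insert Y)
      then show ?thesis using F0[of Y] F1[of Y] G0[of Y] G1[of Y] assms(6)
        by (cases "j \<in> Y") auto
    qed
  qed
qed

text \<open>In direction \<open>i\<close> or \<open>j\<close> the two derivatives are the other
  coordinate and its negation; in every further direction they vanish.\<close>

lemma and_or_noise_eq_quartic_form: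
  assumes "finite V" "boolean V F" "boolean V G" "increasing_on V F" "increasing_on V G"
    and "i \<in> V" "j \<in> V" "i \<noteq> j" "and_or V i j F G" "l \<in> V"
  shows "noise_form (V - {l}) (jump l F) (jump l G) = quartic_form (V - {l}) (jump l F) (jump l G)"
proof -
  have FG: "F X = of_bool (i \<in> X \<and> j \<in> X)" "G X = of_bool (i \<in> X \<or> j \<in> X)" if "X \<subseteq> V" for X
    using assms(9) that by (auto simp: and_or_def)
  have jump: "jump l F X = (if l = i then of_bool (j \<in> X) else if l = j then of_bool (i \<in> X) else 0)"
    "jump l G X = (if l = i then of_bool (j \<notin> X) else if l = j then of_bool (i \<notin> X) else 0)"
    if "X \<subseteq> V - {l}" for X
  proof -
    have "X \<subseteq> V" "insert l X \<subseteq> V" "l \<notin> X" using that assms(10) by auto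
    then show
      "jump l F X = (if l = i then of_bool (j \<in> X) else if l = j then of_bool (i \<in> X) else 0)"
      "jump l G X = (if l = i then of_bool (j \<notin> X) else if l = j then of_bool (i \<notin> X) else 0)"
      using assms(8) by (auto simp: jump_def FG)
  qed
  consider "l = i" | "l = j" "l \<noteq> i" | "l \<noteq> i" "l \<noteq> j" by blast
  then show ?thesis
  proof cases
    case 1
    then show ?thesis
      using assms(1,7,8) jump by (intro noise_eq_quartic_form_opposite[of _ j]) auto
  next
    case 2
    then show ?thesis
      using assms(1,6,8) jump by (intro noise_eq_quartic_form_opposite[of _ i]) auto
  next
    case 3
    then have "\<forall>X\<subseteq>V - {l}. jump l F X = 0"
      using jump(1) by simp
    then show ?thesis
      using assms by (subst noise_eq_quartic_form_iff) (auto intro!: boolean_jump)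
  qed
qed

text \<open>Each direction satisfies \<open>quartic_form \<le> noise_form\<close>, so the sums agree
  only if every direction does. One direction in which neither derivative vanishes already
  determines \<open>F\<close> and \<open>G\<close>.\<close>

lemma covariance_equality_iff:
  assumes fin: "finite V" and F: "boolean V F" "increasing_on V F" and G: "boolean V G" "increasing_on V G"
  shows "hat V (\<lambda>X. F X * G X) {} - hat V F {} * hat V G {}
      = 4 * (\<Sum>S\<in>Pow V - {{}}. real (card S) * (hat V F S)\<^sup>2 * (hat V G S)\<^sup>2)
    \<longleftrightarrow> (\<forall>j\<in>V. (\<forall>X\<subseteq>V - {j}. jump j F X = 0) \<or> (\<forall>X\<subseteq>V - {j}. jump j G X = 0))
      \<or> (\<exists>i\<in>V. \<forall>X\<subseteq>V. F X = of_bool (i \<in> X) \<and> G X = of_bool (i \<in> X))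
      \<or> (\<exists>i\<in>V. \<exists>j\<in>V. i \<noteq> j \<and> (and_or V i j F G \<or> and_or V i j G F))"
    (is "?eq \<longleftrightarrow> ?A \<or> ?B \<or> ?C")
proof -
  let ?L = "\<lambda>j. noise_form (V - {j}) (jump j F) (jump j G)" and ?R = "\<lambda>j. quartic_form (V - {j}) (jump j F) (jump j G)"
  have fin': "finite (V - {j})" for j using fin by simp
  note bF = boolean_jump[OF F] and bG = boolean_jump[OF G]
  have "?eq \<longleftrightarrow> (\<Sum>j\<in>V. ?L j) = (\<Sum>j\<in>V. ?R j)"
    unfolding covariance_eq_sum_noise_form[OF fin] weighted_sum_eq_sum_quartic_form[OF fin] by simp
  also have "\<dots> \<longleftrightarrow> (\<Sum>j\<in>V. ?L j - ?R j) = 0"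
    by (simp add: sum_subtractf)
  also have "\<dots> \<longleftrightarrow> (\<forall>j\<in>V. ?L j - ?R j = 0)"
    using fin quartic_le_noise_form[OF fin' bF bG] by (intro sum_nonneg_eq_0_iff) auto
  also have "\<dots> \<longleftrightarrow> (\<forall>j\<in>V. ?L j = ?R j)"
    by simp
  also have "\<dots> \<longleftrightarrow> ?A \<or> ?B \<or> ?C"
  proof
    assume eq: "\<forall>j\<in>V. ?L j = ?R j"
    show "?A \<or> ?B \<or> ?C"
    proof (cases ?A)
      case False
      \<comment> \<open>Relevance of \<open>i\<close> for both functions excludes the two vanishing
        alternatives of the equality case below.\<close>
      then obtain i where i: "i \<in> V" "\<not> (\<forall>X\<subseteq>V - {i}. jump i F X = 0)" "\<not> (\<forall>X\<subseteq>V - {i}. jump i G X = 0)"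
        by blast
      from iffD1[OF noise_eq_quartic_form_iff[OF fin' bF[OF i(1)] bG[OF i(1)]] bspec[OF eq i(1)]]
      show ?thesis
      proof (elim disjE bexE)
        assume "\<forall>X\<subseteq>V - {i}. jump i F X = 0"
        with i(2) show ?thesis by (rule notE)
      next
        assume "\<forall>X\<subseteq>V - {i}. jump i G X = 0"
        with i(3) show ?thesis by (rule notE)
      next
        assume one: "\<forall>X\<subseteq>V - {i}. jump i F X = 1 \<and> jump i G X = 1"
        have "F X = of_bool (i \<in> X) \<and> G X = of_bool (i \<in> X)" if "X \<subseteq> V" for X
          using jump_one[OF F(1) i(1) _ that] jump_one[OF G(1) i(1) _ that] one by simp
        then have ?B using i(1) by blast
        then show ?thesis by (intro disjI2 disjI1)
      next
        fix j assume j: "j \<in> V - {i}"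
          and "\<forall>X\<subseteq>V - {i}. jump i F X = of_bool (j \<in> X) \<and> jump i G X = of_bool (j \<notin> X)"
        then have "and_or V i j F G"
          by (intro jump_and_or F G i(1))
        then have ?C using j i(1) by (intro bexI[of _ i] bexI[of _ j]) auto
        then show ?thesis by (intro disjI2)
      next
        fix j assume j: "j \<in> V - {i}"
          and "\<forall>X\<subseteq>V - {i}. jump i G X = of_bool (j \<in> X) \<and> jump i F X = of_bool (j \<notin> X)"
        then have "and_or V i j G F"
          by (intro jump_and_or F G i(1))
        then have ?C using j i(1) by (intro bexI[of _ i] bexI[of _ j]) auto
        then show ?thesis by (intro disjI2)
      qed
    qed simp
  next
    assume "?A \<or> ?B \<or> ?C"
    then show "\<forall>j\<in>V. ?L j = ?R j"
    proof (elim disjE bexE conjE)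
      assume ?A
      show ?thesis
      proof
        fix l assume l: "l \<in> V"
        from bspec[OF \<open>?A\<close> l] show "?L l = ?R l"
          unfolding noise_eq_quartic_form_iff[OF fin' bF[OF l] bG[OF l]] by (elim disjE) simp_all
      qed
    next
      fix i assume i: "i \<in> V" "\<forall>X\<subseteq>V. F X = of_bool (i \<in> X) \<and> G X = of_bool (i \<in> X)"
      show ?thesis
      proof
        fix l assume l: "l \<in> V"
        have "jump l F X = of_bool (l = i)" "jump l G X = of_bool (l = i)" if "X \<subseteq> V - {l}" for X
        proof -
          have "X \<subseteq> V" "insert l X \<subseteq> V" "l \<notin> X" using that l by auto
          then show "jump l F X = of_bool (l = i)" "jump l G X = of_bool (l = i)"
            using i(2) by (auto simp: jump_def)
        qed
        then show "?L l = ?R l"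
          unfolding noise_eq_quartic_form_iff[OF fin' bF[OF l] bG[OF l]] by (cases "l = i") simp_all
      qed
    next
      fix i j assume "i \<in> V" "j \<in> V" "i \<noteq> j" "and_or V i j F G"
      then show ?thesis
        by (intro ballI and_or_noise_eq_quartic_form[OF fin F(1) G(1) F(2) G(2), of i j])
    next
      fix i j assume ij: "i \<in> V" "j \<in> V" "i \<noteq> j" "and_or V i j G F"
      show ?thesis
      proof
        fix l assume "l \<in> V"
        with ij have "noise_form (V - {l}) (jump l G) (jump l F) = quartic_form (V - {l}) (jump l G) (jump l F)"
          by (intro and_or_noise_eq_quartic_form[OF fin G(1) F(1) G(2) F(2), of i j])
        then show "?L l = ?R l"
          unfolding forms_commute[of "V - {l}" "jump l F"] .
      qed
    qed
  qed
  finally show ?thesis .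
qed

section \<open>Transfer to the cube of 0-1 vectors\<close>

text \<open>The indicator vector of \<open>X\<close>, made extensional so that it lies in
  \<open>cube n\<close>; elements of \<open>X\<close> outside \<open>{1..n}\<close> are
  ignored.\<close>

definition point :: "nat \<Rightarrow> nat set \<Rightarrow> nat \<Rightarrow> nat" where
  "point n X = (\<lambda>k\<in>{1..n}. of_bool (k \<in> X))"

lemma point_apply: "k \<in> {1..n} \<Longrightarrow> point n X k = of_bool (k \<in> X)"
  by (simp add: point_def)

lemma bij_point: "bij_betw (point n) (Pow {1..n}) (cube n)"
proof (rule bij_betw_byWitness[where f' = "\<lambda>x. {k \<in> {1..n}. x k = 1}"])
  show "\<forall>X\<in>Pow {1..n}. {k \<in> {1..n}. point n X k = 1} = X"
    by (auto simp: point_def)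
  show "\<forall>x\<in>cube n. point n {k \<in> {1..n}. x k = 1} = x"
  proof
    fix x assume x: "x \<in> cube n"
    have "x k \<in> {0, 1}" if "k \<in> {1..n}" for k
      using x that unfolding cube_def by (rule PiE_mem)
    moreover have "x k = undefined" if "k \<notin> {1..n}" for k
      using x that unfolding cube_def by (rule PiE_arb)
    ultimately show "point n {k \<in> {1..n}. x k = 1} = x"
      by (fastforce simp: point_def fun_eq_iff)
  qed
  show "point n ` Pow {1..n} \<subseteq> cube n"
    by (auto simp: point_def cube_def)
  show "(\<lambda>x. {k \<in> {1..n}. x k = 1}) ` cube n \<subseteq> Pow {1..n}"
    by auto
qed

lemma cube_eq: "cube n = point n ` Pow {1..n}"
  using bij_point[of n] by (simp add: bij_betw_def)

lemma ball_cube: "(\<forall>x\<in>cube n. P x) \<longleftrightarrow> (\<forall>X\<subseteq>{1..n}. P (point n X))"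
  by (auto simp: cube_eq)

lemma bex_cube: "(\<exists>x\<in>cube n. P x) \<longleftrightarrow> (\<exists>X\<subseteq>{1..n}. P (point n X))"
  by (auto simp: cube_eq)

lemma finite_cube: "finite (cube n)" and cube_nonempty: "cube n \<noteq> {}" and card_cube: "card (cube n) = 2 ^ n"
  using bij_betw_same_card[OF bij_point, of n] by (auto simp: cube_eq card_Pow)

lemma expect_eq_hat: "expect n f = hat {1..n} (\<lambda>X. f (point n X)) {}"
  using sum.reindex_bij_betw[OF bij_point, of f n]
  by (simp add: expect_def integral_pmf_of_set finite_cube cube_nonempty card_cube hat_empty)

lemma chi_point:
  assumes "S \<subseteq> {1..n}"
  shows "chi S (point n X) = (-1) ^ card (X \<inter> S)"
proof -
  have "(\<Sum>i\<in>S. point n X i) = (\<Sum>i\<in>S. if i \<in> X then 1 else 0)"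
    using assms by (intro sum.cong) (auto simp: point_def)
  also have "\<dots> = card (X \<inter> S)"
    using assms finite_subset[of S "{1..n}"] by (simp add: sum.If_cases Int_commute)
  finally show ?thesis by (simp add: chi_def)
qed

lemma fourier_eq_hat:
  assumes "S \<subseteq> {1..n}"
  shows "fourier n f S = hat {1..n} (\<lambda>X. f (point n X)) S"
  unfolding fourier_def expect_eq_hat hat_empty chi_point[OF assms] by (simp add: hat_def mult.commute)

lemma cov_eq_hat:
  "cov n f g = hat {1..n} (\<lambda>X. f (point n X) * g (point n X)) {}
    - hat {1..n} (\<lambda>X. f (point n X)) {} * hat {1..n} (\<lambda>X. g (point n X)) {}"
  by (simp add: cov_def expect_eq_hat)

lemma cube_add_point:
  "cube_add n (point n X) (basis_vec n i) = point n (if i \<in> X then X - {i} else insert i X)"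
  by (auto simp: cube_add_def basis_vec_def point_def fun_eq_iff)

text \<open>Under the uniform measure an event has positive probability as soon as one point of the
  cube lies in it.\<close>

lemma relevant_iff:
  "i \<in> relevant n f \<longleftrightarrow> i \<in> {1..n} \<and> (\<exists>X\<subseteq>{1..n} - {i}. jump i (\<lambda>X. f (point n X)) X \<noteq> 0)"
proof (cases "i \<in> {1..n}")
  case True
  have "influence n f i > 0 \<longleftrightarrow> cube n \<inter> {x. f x \<noteq> f (cube_add n x (basis_vec n i))} \<noteq> {}"
    unfolding influence_def measure_pmf_of_set[OF cube_nonempty finite_cube]
    by (simp add: card_gt_0_iff finite_cube cube_nonempty zero_less_divide_iff)
  also have "\<dots> \<longleftrightarrow> (\<exists>x\<in>cube n. f x \<noteq> f (cube_add n x (basis_vec n i)))"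
    by blast
  also have "\<dots> \<longleftrightarrow> (\<exists>X\<subseteq>{1..n}. f (point n X) \<noteq> f (point n (if i \<in> X then X - {i} else insert i X)))"
    by (simp only: bex_cube cube_add_point)
  also have "\<dots> \<longleftrightarrow> (\<exists>X\<subseteq>{1..n} - {i}. f (point n (insert i X)) \<noteq> f (point n X))"
  proof (intro iffI; elim exE conjE)
    fix X assume X: "X \<subseteq> {1..n}" "f (point n X) \<noteq> f (point n (if i \<in> X then X - {i} else insert i X))"
    \<comment> \<open>A flip in coordinate \<open>i\<close> compares the same two points from either
      end, so the end without \<open>i\<close> can be chosen.\<close>
    have "f (point n (insert i (X - {i}))) \<noteq> f (point n (X - {i}))"
      using X(2) by (cases "i \<in> X") (auto simp: insert_absorb)
    then show "\<exists>X\<subseteq>{1..n} - {i}. f (point n (insert i X)) \<noteq> f (point n X)"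
      using X(1) by (intro exI[of _ "X - {i}"]) auto
  next
    fix X assume X: "X \<subseteq> {1..n} - {i}" "f (point n (insert i X)) \<noteq> f (point n X)"
    then have "i \<notin> X" "X \<subseteq> {1..n}" by auto
    then show "\<exists>X\<subseteq>{1..n}. f (point n X) \<noteq> f (point n (if i \<in> X then X - {i} else insert i X))"
      using X(2) by (intro exI[of _ X]) simp
  qed
  finally show ?thesis
    using True by (simp add: relevant_def jump_def)
next
  case False
  then show ?thesis
    unfolding relevant_def by blast
qed

lemma boolean_point:
  assumes "f \<in> cube n \<rightarrow> {0, 1}"
  shows "boolean {1..n} (\<lambda>X. f (point n X))"
  using assms by (auto simp: boolean_def cube_eq)

lemma increasing_point:
  assumes "mono_on (cube n) f"
  shows "increasing_on {1..n} (\<lambda>X. f (point n X))"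
  unfolding increasing_on_def
proof (intro allI impI)
  fix X Y assume "X \<subseteq> Y" "Y \<subseteq> {1..n}"
  moreover have "point n X \<le> point n Y"
    using \<open>X \<subseteq> Y\<close> by (auto simp: point_def le_fun_def)
  ultimately show "f (point n X) \<le> f (point n Y)"
    using assms by (intro mono_onD[OF assms]) (auto simp: cube_eq)
qed

lemma and_or_pair_iff:
  assumes "i \<in> {1..n}" "j \<in> {1..n}"
  shows "and_or_pair n i j f g \<longleftrightarrow> and_or {1..n} i j (\<lambda>X. f (point n X)) (\<lambda>X. g (point n X))"
proof -
  have "real (point n X i) * real (point n X j) = of_bool (i \<in> X \<and> j \<in> X)"
    "1 - (1 - real (point n X i)) * (1 - real (point n X j)) = of_bool (i \<in> X \<or> j \<in> X)" for X
    using assms by (auto simp: point_apply)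
  then show ?thesis
    by (simp only: and_or_pair_def and_or_def ball_cube)
qed

theorem theorem1p4:
  fixes n :: nat and f g :: "(nat \<Rightarrow> nat) \<Rightarrow> real"
  assumes "f \<in> cube n \<rightarrow> {0, 1}" and "g \<in> cube n \<rightarrow> {0, 1}"
    and "mono_on (cube n) f" and "mono_on (cube n) g"
  shows "cov n f g =
           4 * (\<Sum>S \<in> Pow {1..n} - {{}}. real (card S) * (fourier n f S)\<^sup>2 * (fourier n g S)\<^sup>2)
     \<longleftrightarrow>
       relevant n f \<inter> relevant n g = {}
     \<or> (\<exists>i \<in> {1..n}. \<forall>x \<in> cube n. f x = real (x i) \<and> g x = real (x i))
     \<or> (\<exists>i \<in> {1..n}. \<exists>j \<in> {1..n}. i \<noteq> j \<and> (and_or_pair n i j f g \<or> and_or_pair n i j g f))"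
proof -
  let ?V = "{1..n}" and ?F = "\<lambda>X. f (point n X)" and ?G = "\<lambda>X. g (point n X)"
  have "(\<Sum>S\<in>Pow ?V - {{}}. real (card S) * (fourier n f S)\<^sup>2 * (fourier n g S)\<^sup>2)
      = (\<Sum>S\<in>Pow ?V - {{}}. real (card S) * (hat ?V ?F S)\<^sup>2 * (hat ?V ?G S)\<^sup>2)"
    by (intro sum.cong refl) (simp add: fourier_eq_hat)
  \<comment> \<open>Disjointness means that in each direction at least one of the two derivatives
    vanishes identically.\<close>
  moreover have "relevant n f \<inter> relevant n g = {} \<longleftrightarrow>
      (\<forall>j\<in>?V. (\<forall>X\<subseteq>?V - {j}. jump j ?F X = 0) \<or> (\<forall>X\<subseteq>?V - {j}. jump j ?G X = 0))"
    unfolding disjoint_iff relevant_iff by blast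
  moreover have "(\<exists>i\<in>?V. \<forall>x\<in>cube n. f x = real (x i) \<and> g x = real (x i)) \<longleftrightarrow>
      (\<exists>i\<in>?V. \<forall>X\<subseteq>?V. ?F X = of_bool (i \<in> X) \<and> ?G X = of_bool (i \<in> X))"
    unfolding ball_cube by (intro bex_cong refl) (simp add: point_apply)
  moreover have "(\<exists>i\<in>?V. \<exists>j\<in>?V. i \<noteq> j \<and> (and_or_pair n i j f g \<or> and_or_pair n i j g f)) \<longleftrightarrow>
      (\<exists>i\<in>?V. \<exists>j\<in>?V. i \<noteq> j \<and> (and_or ?V i j ?F ?G \<or> and_or ?V i j ?G ?F))"
    by (intro bex_cong refl) (simp only: and_or_pair_iff)
  ultimately show ?thesis
    using covariance_equality_iff[OF finite_atLeastAtMost boolean_point increasing_point boolean_point increasing_point,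
        OF assms(1,3,2,4)]
    by (simp only: cov_eq_hat)
qed

end
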